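(* Let $\bm{}\mathbf U_h^{n-\ell}$, $0\le\ell\le m-1$, be previous solutions such that each $\mathbf U_h^{n-\ell}$ with $c_{\ell,n}>0$ is admissible in the sense of the context (nodal values on every $\mathcal X_K$ in $\mathcal G$, magnetic constraint satisfied, exterior boundary traces in $\mathcal G$). Assume the coefficients satisfy $$c_{\ell,n},d_{\ell,n}\ge0,\qquad\sum_{\ell=0}^{m-1}c_{\ell,n}=1,\qquad c_{\ell,n}=0\Rightarrow d_{\ell,n}=0,$$ and the time step $\Delta t_n>0$ satisfies $$\Delta t_n\le\min_{\ell:\,d_{\ell,n}>0}\frac{c_{\ell,n}}{d_{\ell,n}}\,\tau_{\rm FE}(\mathbf U_h^{n-\ell}).$$ Then the provisional multistep update $$\mathbf U_h^{n+1,\star}=\sum_{\ell:\,c_{\ell,n}>0}c_{\ell,n}\mathbf Y_h(\mathbf U_h^{n-\ell};\tau_{\ell,n}),\qquad\tau_{\ell,n}=\frac{d_{\ell,n}}{c_{\ell,n}}\Delta t_n,$$ satisfies, for every $K\in\mathcal T_h$, $$\overline{\mathbf U}_K^{n+1,\star}\in\mathcal G,\qquad\eta_r(\overline{\mathbf U}_K^{n+1,\star})\le\mathcal B_{K,r}^{n,\rm MS},\quad1\le r\le M .$$ Furthermore, the lifted polynomial $\mathbf U_K^{n+1}$, obtained from $\mathbf U_K^{n+1,\star}$ by the weak-to-strong lifting with $\mathbf W_K=\overline{\mathbf U}_K^{n+1,\star}$ and $\mathcal B_{K,r}=\mathcal B_{K,r}^{n,\rm MS}$, preserves the cell average ($\overline{\mathbf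 U}_K^{n+1}=\overline{\mathbf U}_K^{n+1,\star}$), satisfies the magnetic constraint ($B_{1,K}^{n+1}\equiv B_{\rm const}$ if $d=1$; $\sum_{i=1}^d\partial_{x_i}B_{i,K}^{n+1}=0$ in $K$ if $d\in\{2,3\}$), has values in $\mathcal G$ on $\mathcal X_K$, and obeys $$\mathcal S_{K,r}(\mathbf U_K^{n+1})\le\mathcal B_{K,r}^{n,\rm MS},\qquad1\le r\le M .$$
   Context: **States, flux, entropies.** Fix $\gamma>1$, $d\in\{1,2,3\}$. A state is $\mathbf U=(\rho,\mathbf m^\top,\mathbf B^\top,E)^\top\in\mathbb R^8$ with $\mathbf m,\mathbf B\in\mathbb R^3$; $\mathbf v=\mathbf m/\rho$, $p=(\gamma-1)(E-\frac{|\mathbf m|^2}{2\rho}-\frac{|\mathbf B|^2}{2})$, $p_{\rm tot}=p+\frac{|\mathbf B|^2}2$; $\mathcal G=\{\mathbf U:\rho>0,\ E-\frac{|\mathbf m|^2}{2\rho}-\frac{|\mathbf B|^2}{2}>0\}$. $\mathbf F_i(\mathbf U)=(\rho v_i,(v_i\mathbf m-B_i\mathbf B+p_{\rm tot}\mathbf e_i)^\top,(v_i\mathbf B-B_i\mathbf v)^\top,v_i(E+p_{\rm tot})-B_i(\mathbf v\cdot\mathbf B))^\top$; $\mathbf S(\mathbf U)=(0,\mathbf B^\top,\mathbf v^\top,\mathbf v\cdot\mathbf B)^\top$. $f_1,\dots,f_M\in C^2(\mathbb R)$ satisfy $f_r'>0$, $f_r'-\gamma f_r''>0$ on $\mathbb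 R$; with $s=\log p-\gamma\log\rho$, $\eta_r(\mathbf U)=-\rho f_r(s)$ on $\mathcal G$. For a unit vector $\mathbf n$: $\mathbf F_{\mathbf n}=\sum_{i=1}^dn_i\mathbf F_i$, $B_{\mathbf n}=\mathbf B\cdot\mathbf n$, $q_{r,\mathbf n}=\eta_r\,\mathbf v\cdot\mathbf n$. **Mesh, quadrature, admissible fields.** $\mathcal T_h$ is a finite mesh: uniform intervals $I_j=[x_{j-1/2},x_{j+1/2}]$, $1\le j\le N_x$, if $d=1$; a conforming mesh of bounded polytopes with planar faces if $d\in\{2,3\}$. Each cell has a quadrature with nodes $\mathbf x_{K,a}$ and weights $\omega_{K,a}>0$, $\sum_a\omega_{K,a}=1$, exact for cell averages of $\mathbb P^k(K)$; its nodes include the endpoints ($d=1$, Gauss–Lobatto rule) or all face quadrature points ($d\in\{2,3\}$). $\mathcal X_K\subset K$ is a finite set containing all these nodes. Face quadratures ($d\in\{2,3\}$): on each face $e$, points $\mathbf x_{e,q}$ and weights $\varpi_{e,q}>0$ with $\sum_q\varpi_{e,q}=1$, exact for averages of $\mathbb P^k(e)$ and common to both adjacent cells; $\mathcal I_K^\partial$ is the set of $\nu=(e,q)$ with $e\subset\partial K$, $c_{K,\nu}=|e|\varpi_{e,q}$, $\mathbf n_{K,\nu}$ the outward unit normal. A field $\mathbf U_h=(\mathbf U_K)_{K\in\mathcal T_h}$, $\mathbf U_K\in[\mathbb P^k(K)]^8$, is admissible if $\mathbf U_K(\mathbf x)\in\mathcal G$ for $\mathbf x\in\mathcal X_K$,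 if it satisfies the magnetic constraint ($B_{1,K}\equiv B_{\rm const}$, a fixed constant, for $d=1$; $\sum_{i=1}^d\partial_{x_i}B_{i,K}=0$ in $K$ for $d\in\{2,3\}$), and if the prescribed exterior boundary traces lie in $\mathcal G$ (for $d=1$ also with $B_1=B_{\rm const}$). Bars denote cell averages. $\mathcal S_{K,r}(\mathbf U_K)=\sum_a\omega_{K,a}\eta_r(\mathbf U_K(\mathbf x_{K,a}))$. **Interface fluxes.** At an interface point with traces $\mathbf U^\mp$, normal $\mathbf n$ from the minus to the plus side ($\mathbf n=\mathbf e_1$ if $d=1$) and wave speeds $a^-<0<a^+$ (one pair shared by both cells; under reversal $(a^-,a^+)\mapsto(-a^+,-a^-)$): $\widehat{\mathbf F}_{\mathbf n}=\frac{a^+\mathbf F_{\mathbf n}(\mathbf U^-)-a^-\mathbf F_{\mathbf n}(\mathbf U^+)+a^+a^-(\mathbf U^+-\mathbf U^-)}{a^+-a^-}$, $\widehat q_r=\frac{a^+q_{r,\mathbf n}(\mathbf U^-)-a^-q_{r,\mathbf n}(\mathbf U^+)+a^+a^-[\eta_r(\mathbf U^+)-\eta_r(\mathbf U^-)]}{a^+-a^-}$. For $d\in\{2,3\}$, subscript $K,\nu$ means evaluation with interior trace of $K$ as $\mathbf U^-$, exterior trace as $\mathbf U^+$ and $\mathbf n=\mathbf n_{K,\nu}$, and $\mathbf G_{K,\nu}=\widehat{\mathbf F}_{K,\nu}-\frac{a^-_{K,\nu}}{a^+_{K,\nu}-a^-_{K,\nu}}\big(B_{\mathbf n_{K,\nu}}(\mathbf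 U^+)-B_{\mathbf n_{K,\nu}}(\mathbf U^-)\big)\mathbf S(\mathbf U^-)$. Set $\mathcal F_{K,r}(\mathbf U_h)=\widehat q_{j+1/2,r}-\widehat q_{j-1/2,r}$ for $d=1$, $K=I_j$, and $\mathcal F_{K,r}(\mathbf U_h)=\sum_{\nu\in\mathcal I_K^\partial}c_{K,\nu}\widehat q_{K,\nu,r}$ for $d\in\{2,3\}$. **Spatial residual and forward Euler property (standing assumptions).** $\mathcal L_h$ maps an admissible field to a field in $\prod_K[\mathbb P^k(K)]^8$ whose cell averages are $-\frac1{|K|}(\widehat{\mathbf F}_{1,j+1/2}-\widehat{\mathbf F}_{1,j-1/2})$ ($d=1$, $K=I_j$) or $-\frac1{|K|}\sum_\nu c_{K,\nu}\mathbf G_{K,\nu}$ ($d\in\{2,3\}$), and whose magnetic part is compatible with the constraint: its $B_1$ component vanishes ($d=1$), or its magnetic components are divergence-free in each $K$ ($d\in\{2,3\}$). Put $\mathbf Y_h(\mathbf U_h;\tau)=\mathbf U_h+\tau\mathcal L_h(\mathbf U_h)$ and $\mathcal B_{K,r}^{\rm FE}(\mathbf U_h;\tau)=\mathcal S_{K,r}(\mathbf U_K)-\frac\tau{|K|}\mathcal F_{K,r}(\mathbf U_h)$. For each admissible $\mathbf U_h$ the wave speeds are chosen, together with a bound $\tau_{\rm FE}(\mathbf U_h)>0$, so that for all $0\le\tau\le\tau_{\rm FE}(\mathbf U_h)$, all $K$ and all $1\le r\le M$: $\overline{\mathbf Y}_K(\mathbf U_h;\tau)\in\mathcal G$ and $\eta_r(\overline{\mathbf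 Y}_K(\mathbf U_h;\tau))\le\mathcal B_{K,r}^{\rm FE}(\mathbf U_h;\tau)$. **Multistep budget.** $\mathcal B_{K,r}^{n,\rm MS}=\sum_\ell c_{\ell,n}\mathcal B_{K,r}^{\rm FE}(\mathbf U_h^{n-\ell};\tau_{\ell,n})=\sum_\ell c_{\ell,n}\mathcal S_{K,r}(\mathbf U_K^{n-\ell})-\frac{\Delta t_n}{|K|}\sum_\ell d_{\ell,n}\mathcal F_{K,r}(\mathbf U_h^{n-\ell})$ (terms with $c_{\ell,n}=0$ omitted). **Weak-to-strong lifting** of $\mathbf U_K^\star$ with average $\mathbf W_K\in\mathcal G$ and bounds $\mathcal B_{K,r}\ge\eta_r(\mathbf W_K)$: choose $0<\epsilon_{\rho,K}<\rho(\mathbf W_K)$, $0<\epsilon_{p,K}<p(\mathbf W_K)$, $\mathcal G_{K,\epsilon}=\{\mathbf U\in\mathcal G:\rho\ge\epsilon_{\rho,K},p\ge\epsilon_{p,K}\}$; $\theta_K^{\rm PP}=\max\{\theta\in[0,1]:\mathbf W_K+\theta(\mathbf U_K^\star(\mathbf x)-\mathbf W_K)\in\mathcal G_{K,\epsilon}\ \forall\mathbf x\in\mathcal X_K\}$, $\mathbf U_K^{\rm PP}=\mathbf W_K+\theta_K^{\rm PP}(\mathbf U_K^\star-\mathbf W_K)$; $\Phi_{K,r}(\vartheta)=\mathcal S_{K,r}(\mathbf W_K+\vartheta(\mathbf U_K^{\rm PP}-\mathbf W_K))$; $\vartheta_{K,r}=1$ if $\Phi_{K,r}(1)\le\mathcal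 B_{K,r}$, otherwise $\vartheta_{K,r}\in[0,1)$ is the unique root of $\Phi_{K,r}(\vartheta)=\mathcal B_{K,r}$; the lifted polynomial is $\mathbf W_K+\theta_K^{\rm PP}(\min_r\vartheta_{K,r})(\mathbf U_K^\star-\mathbf W_K)$. *)

theory Defs
  imports "HOL-Analysis.Analysis"
begin

section \<open>States, fluxes, entropies\<close>

text \<open>A state is \<open>(\<rho>, m, B, E)\<close>; the product type is the Euclidean space of dimension 8.\<close>
type_synonym state = "real \<times> (real^3) \<times> (real^3) \<times> real"

definition dens :: "state \<Rightarrow> real" where "dens U = fst U"
definition mom :: "state \<Rightarrow> real^3" where "mom U = fst (snd U)"
definition mag :: "state \<Rightarrow> real^3" where "mag U = fst (snd (snd U))"
definition ener :: "state \<Rightarrow> real" where "ener U = snd (snd (snd U))"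

definition vel :: "state \<Rightarrow> real^3" where
  "vel U = (1 / dens U) *\<^sub>R mom U"

definition int_ener :: "state \<Rightarrow> real" where
  "int_ener U = ener U - (norm (mom U))\<^sup>2 / (2 * dens U) - (norm (mag U))\<^sup>2 / 2"

definition pres :: "real \<Rightarrow> state \<Rightarrow> real" where
  "pres \<gamma> U = (\<gamma> - 1) * int_ener U"

definition ptot :: "real \<Rightarrow> state \<Rightarrow> real" where
  "ptot \<gamma> U = pres \<gamma> U + (norm (mag U))\<^sup>2 / 2"

definition Gset :: "state set" where
  "Gset = {U. dens U > 0 \<and> int_ener U > 0}"

definition flux :: "real \<Rightarrow> 3 \<Rightarrow> state \<Rightarrow> state" where
  "flux \<gamma> i U =
    (dens U * vel U $ i,
     vel U $ i *\<^sub>R mom U - mag U $ i *\<^sub>R mag U + ptot \<gamma> U *\<^sub>R axis i 1,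
     vel U $ i *\<^sub>R mag U - mag U $ i *\<^sub>R vel U,
     vel U $ i * (ener U + ptot \<gamma> U) - mag U $ i * (vel U \<bullet> mag U))"

definition source :: "state \<Rightarrow> state" where
  "source U = (0, mag U, vel U, vel U \<bullet> mag U)"

definition C2 :: "(real \<Rightarrow> real) \<Rightarrow> bool" where
  "C2 f \<longleftrightarrow> f differentiable_on UNIV \<and> deriv f differentiable_on UNIV
     \<and> continuous_on UNIV (deriv (deriv f))"

definition admissible_entropy_fun :: "real \<Rightarrow> (real \<Rightarrow> real) \<Rightarrow> bool" where
  "admissible_entropy_fun \<gamma> f \<longleftrightarrow> C2 f \<and>
     (\<forall>s. deriv f s > 0 \<and> deriv f s - \<gamma> * deriv (deriv f) s > 0)"

definition spec_entropy :: "real \<Rightarrow> state \<Rightarrow> real" where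
  "spec_entropy \<gamma> U = ln (pres \<gamma> U) - \<gamma> * ln (dens U)"

definition eta :: "real \<Rightarrow> (real \<Rightarrow> real) \<Rightarrow> state \<Rightarrow> real" where
  "eta \<gamma> f U = - dens U * f (spec_entropy \<gamma> U)"

text \<open>
  The space dimension is \<open>d = CARD('d)\<close>. A map \<open>\<iota> :: 'd \<Rightarrow> 3\<close> labels the coordinates of
  \<open>real^'d\<close> by \<open>1, \<dots>, d\<close>, and thereby identifies a vector \<open>n\<close> of \<open>real^'d\<close> with a vector of
  \<open>real^3\<close>. (In the type \<open>3\<close> the numerals \<open>0\<close> and \<open>3\<close> denote the same element.)
\<close>
definition coord_labelling :: "('d::finite \<Rightarrow> 3) \<Rightarrow> bool" where
  "coord_labelling \<iota> \<longleftrightarrow> bij_betw \<iota> UNIV (of_nat ` {1..CARD('d)})"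

definition embed3 :: "('d::finite \<Rightarrow> 3) \<Rightarrow> real^'d \<Rightarrow> real^3" where
  "embed3 \<iota> n = (\<Sum>i\<in>UNIV. n $ i *\<^sub>R axis (\<iota> i) 1)"

definition flux_n :: "real \<Rightarrow> ('d::finite \<Rightarrow> 3) \<Rightarrow> real^'d \<Rightarrow> state \<Rightarrow> state" where
  "flux_n \<gamma> \<iota> n U = (\<Sum>i\<in>UNIV. n $ i *\<^sub>R flux \<gamma> (\<iota> i) U)"

definition mag_n :: "('d::finite \<Rightarrow> 3) \<Rightarrow> real^'d \<Rightarrow> state \<Rightarrow> real" where
  "mag_n \<iota> n U = mag U \<bullet> embed3 \<iota> n"

definition ent_flux_n ::
  "real \<Rightarrow> (real \<Rightarrow> real) \<Rightarrow> ('d::finite \<Rightarrow> 3) \<Rightarrow> real^'d \<Rightarrow> state \<Rightarrow> real" where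
  "ent_flux_n \<gamma> f \<iota> n U = eta \<gamma> f U * (vel U \<bullet> embed3 \<iota> n)"

section \<open>Interface fluxes\<close>

text \<open>Argument order: normal \<open>n\<close>, wave speeds \<open>am < 0 < ap\<close>, traces \<open>Um\<close> and \<open>Up\<close>, where
  \<open>n\<close> points from the minus to the plus side.\<close>

definition hll_flux ::
  "real \<Rightarrow> ('d::finite \<Rightarrow> 3) \<Rightarrow> real^'d \<Rightarrow> real \<Rightarrow> real \<Rightarrow> state \<Rightarrow> state \<Rightarrow> state" where
  "hll_flux \<gamma> \<iota> n am ap Um Up = (1 / (ap - am)) *\<^sub>R
     (ap *\<^sub>R flux_n \<gamma> \<iota> n Um - am *\<^sub>R flux_n \<gamma> \<iota> n Up + (ap * am) *\<^sub>R (Up - Um))"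

definition hll_ent_flux ::
  "real \<Rightarrow> (real \<Rightarrow> real) \<Rightarrow> ('d::finite \<Rightarrow> 3) \<Rightarrow> real^'d \<Rightarrow> real \<Rightarrow> real \<Rightarrow> state \<Rightarrow> state \<Rightarrow> real"
  where
  "hll_ent_flux \<gamma> f \<iota> n am ap Um Up =
     (ap * ent_flux_n \<gamma> f \<iota> n Um - am * ent_flux_n \<gamma> f \<iota> n Up
        + ap * am * (eta \<gamma> f Up - eta \<gamma> f Um)) / (ap - am)"

definition hll_source_flux ::
  "real \<Rightarrow> ('d::finite \<Rightarrow> 3) \<Rightarrow> real^'d \<Rightarrow> real \<Rightarrow> real \<Rightarrow> state \<Rightarrow> state \<Rightarrow> state" where
  "hll_source_flux \<gamma> \<iota> n am ap Um Up = hll_flux \<gamma> \<iota> n am ap Um Up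
     - (am / (ap - am) * (mag_n \<iota> n Up - mag_n \<iota> n Um)) *\<^sub>R source Um"

section \<open>Polynomials, averages\<close>

definition poly_space :: "nat \<Rightarrow> (real^'d::finite \<Rightarrow> 'b::real_vector) set" where
  "poly_space k = {g. \<exists>c. \<forall>x. g x =
     (\<Sum>\<alpha> | sum \<alpha> UNIV \<le> k. (\<Prod>i\<in>UNIV. (x $ i) ^ \<alpha> i) *\<^sub>R c \<alpha>)}"

lemma finite_multi_indices: "finite {\<alpha> :: 'd::finite \<Rightarrow> nat. sum \<alpha> UNIV \<le> k}"
proof (rule finite_subset)
  show "{\<alpha> :: 'd \<Rightarrow> nat. sum \<alpha> UNIV \<le> k} \<subseteq> Pi\<^sub>E UNIV (\<lambda>_. {..k})"
  proof
    fix \<alpha> :: "'d \<Rightarrow> nat" assume "\<alpha> \<in> {\<alpha>. sum \<alpha> UNIV \<le> k}"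
    then have "\<alpha> i \<le> k" for i
      using member_le_sum[of i UNIV \<alpha>] by simp
    then show "\<alpha> \<in> Pi\<^sub>E UNIV (\<lambda>_. {..k})" by (simp add: PiE_iff)
  qed
  show "finite (Pi\<^sub>E (UNIV :: 'd set) (\<lambda>_. {..k}))"
    by (rule finite_PiE) simp_all
qed

definition volume :: "(real^'d::finite) set \<Rightarrow> real" where
  "volume K = measure lebesgue K"

definition cell_avg :: "(real^'d::finite) set \<Rightarrow> (real^'d \<Rightarrow> 'b::real_normed_vector) \<Rightarrow> 'b" where
  "cell_avg K g = (1 / volume K) *\<^sub>R integral K g"

text \<open>
  The surface measure of a planar set \<open>e\<close> with unit normal \<open>n\<close> is the Lebesgue measure of the
  right prism of height 1 over \<open>e\<close>, and a surface integral is the integral over the prism of the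
  extension of the integrand that is constant along \<open>n\<close>. Neither depends on the sign of \<open>n\<close>.
\<close>
definition prism :: "real^'d::finite \<Rightarrow> (real^'d) set \<Rightarrow> (real^'d) set" where
  "prism n e = {x + t *\<^sub>R n | x t. x \<in> e \<and> 0 \<le> t \<and> t \<le> 1}"

definition face_area :: "real^'d::finite \<Rightarrow> (real^'d) set \<Rightarrow> real" where
  "face_area n e = measure lebesgue (prism n e)"

definition face_proj :: "real^'d::finite \<Rightarrow> (real^'d) set \<Rightarrow> real^'d \<Rightarrow> real^'d" where
  "face_proj n e y = y - (n \<bullet> y - (THE c. \<forall>x\<in>e. n \<bullet> x = c)) *\<^sub>R n"

definition face_avg :: "real^'d::finite \<Rightarrow> (real^'d) set \<Rightarrow> (real^'d \<Rightarrow> real) \<Rightarrow> real" where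
  "face_avg n e g = integral (prism n e) (\<lambda>y. g (face_proj n e y)) / face_area n e"

section \<open>Discretisation data\<close>

type_synonym 'd pfield = "(real, 'd) vec set \<Rightarrow> (real, 'd) vec \<Rightarrow> state"

text \<open>A discrete field: the cellwise polynomials (as functions on the whole space, relevant on the
  cells of the mesh) and the exterior boundary traces that go with them. The latter are indexed by
  the boundary face and the point on it; for \<open>d = 1\<close> the face is a singleton.\<close>
type_synonym 'd dfield = "'d pfield \<times> 'd pfield"

text \<open>
  \<open>num_cells\<close>, \<open>xhalf\<close>, \<open>speed1_minus\<close>, \<open>speed1_plus\<close>, \<open>B_const\<close> are used only for \<open>d = 1\<close>, where
  \<open>xhalf D j\<close> is $x_{j+1/2}$, and \<open>faces\<close>, \<open>normal\<close>, \<open>fnodes\<close>, \<open>fweight\<close>, \<open>speed_minus\<close>, \<open>speed_plus\<close>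
  only for \<open>d = 2, 3\<close>. A quadrature rule is given by its finite set of nodes and the weight of each
  node. The wave speeds, the residual and the time step bound depend on the field.
\<close>
record 'd scheme =
  gam :: real
  num_ent :: nat
  ent_fun :: "nat \<Rightarrow> real \<Rightarrow> real"
  deg :: nat
  lab :: "'d \<Rightarrow> 3"
  B_const :: real
  num_cells :: nat
  xhalf :: "nat \<Rightarrow> real"
  cells :: "(real, 'd) vec set set"
  faces :: "(real, 'd) vec set \<Rightarrow> (real, 'd) vec set set"
  normal :: "(real, 'd) vec set \<Rightarrow> (real, 'd) vec set \<Rightarrow> (real, 'd) vec"
  nodes :: "(real, 'd) vec set \<Rightarrow> (real, 'd) vec set"
  weight :: "(real, 'd) vec set \<Rightarrow> (real, 'd) vec \<Rightarrow> real"
  check_set :: "(real, 'd) vec set \<Rightarrow> (real, 'd) vec set"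
  fnodes :: "(real, 'd) vec set \<Rightarrow> (real, 'd) vec set"
  fweight :: "(real, 'd) vec set \<Rightarrow> (real, 'd) vec \<Rightarrow> real"
  speed1_minus :: "'d dfield \<Rightarrow> nat \<Rightarrow> real"
  speed1_plus :: "'d dfield \<Rightarrow> nat \<Rightarrow> real"
  speed_minus :: "'d dfield \<Rightarrow> (real, 'd) vec set \<Rightarrow> (real, 'd) vec set \<Rightarrow> (real, 'd) vec \<Rightarrow> real"
  speed_plus :: "'d dfield \<Rightarrow> (real, 'd) vec set \<Rightarrow> (real, 'd) vec set \<Rightarrow> (real, 'd) vec \<Rightarrow> real"
  residual :: "'d dfield \<Rightarrow> 'd pfield"
  tau_FE :: "'d dfield \<Rightarrow> real"

abbreviation entropy :: "'d::finite scheme \<Rightarrow> nat \<Rightarrow> state \<Rightarrow> real" where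
  "entropy D r \<equiv> eta (gam D) (ent_fun D r)"

subsection \<open>Mesh\<close>

definition interface_pt :: "'d::finite scheme \<Rightarrow> nat \<Rightarrow> real^'d" where
  "interface_pt D j = vec (xhalf D j)"

text \<open>$I_j = [x_{j-1/2}, x_{j+1/2}]$, for $j \ge 1$.\<close>
definition interval_cell :: "'d::finite scheme \<Rightarrow> nat \<Rightarrow> (real^'d) set" where
  "interval_cell D j = cbox (interface_pt D (j - 1)) (interface_pt D j)"

definition uniform_mesh :: "'d::finite scheme \<Rightarrow> bool" where
  "uniform_mesh D \<longleftrightarrow> num_cells D \<ge> 1
     \<and> (\<exists>h>0. \<forall>j<num_cells D. xhalf D (Suc j) - xhalf D j = h)
     \<and> cells D = interval_cell D ` {1..num_cells D}"

text \<open>The polytopes (cells and planar faces) need not be convex: finite unions of convex ones.\<close>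
definition general_polytope :: "(real^'d::finite) set \<Rightarrow> bool" where
  "general_polytope P \<longleftrightarrow> (\<exists>\<P>. finite \<P> \<and> (\<forall>Q\<in>\<P>. polytope Q) \<and> P = \<Union>\<P>)"

definition outward_unit_normal ::
  "(real^'d::finite) set \<Rightarrow> (real^'d) set \<Rightarrow> real^'d \<Rightarrow> bool" where
  "outward_unit_normal K e n \<longleftrightarrow> norm n = 1 \<and> (\<exists>c. \<forall>x\<in>e. n \<bullet> x = c) \<and>
     (\<forall>x\<in>rel_interior e. \<exists>\<delta>>0. \<forall>t. 0 < t \<and> t < \<delta> \<longrightarrow>
        x - t *\<^sub>R n \<in> interior K \<and> x + t *\<^sub>R n \<notin> K)"

definition polytopal_cell :: "'d::finite scheme \<Rightarrow> (real^'d) set \<Rightarrow> bool" where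
  "polytopal_cell D K \<longleftrightarrow> K \<noteq> {} \<and> general_polytope K \<and> closure (interior K) = K
     \<and> finite (faces D K) \<and> \<Union>(faces D K) = frontier K
     \<and> (\<forall>e\<in>faces D K. general_polytope e \<and> aff_dim e = int CARD('d) - 1
          \<and> closure (rel_interior e) = e \<and> outward_unit_normal K e (normal D K e))
     \<and> (\<forall>e\<in>faces D K. \<forall>e'\<in>faces D K. e \<noteq> e' \<longrightarrow> rel_interior e \<inter> rel_interior e' = {})"

text \<open>Conformity: cells do not overlap, and faces of different cells that overlap are equal.\<close>
definition conforming_mesh :: "'d::finite scheme \<Rightarrow> bool" where
  "conforming_mesh D \<longleftrightarrow> finite (cells D) \<and> (\<forall>K\<in>cells D. polytopal_cell D K)
     \<and> (\<forall>K\<in>cells D. \<forall>K'\<in>cells D. K \<noteq> K' \<longrightarrow> interior K \<inter> interior K' = {}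
          \<and> (\<forall>e\<in>faces D K. \<forall>e'\<in>faces D K'. e \<noteq> e' \<longrightarrow> rel_interior e \<inter> rel_interior e' = {}))"

subsection \<open>Quadrature\<close>

definition cell_quadrature :: "'d::finite scheme \<Rightarrow> (real^'d) set \<Rightarrow> bool" where
  "cell_quadrature D K \<longleftrightarrow> finite (nodes D K) \<and> (\<forall>x\<in>nodes D K. weight D K x > 0)
     \<and> (\<Sum>x\<in>nodes D K. weight D K x) = 1
     \<and> (\<forall>g\<in>poly_space (deg D). (\<Sum>x\<in>nodes D K. weight D K x * g x) = cell_avg K g)
     \<and> finite (check_set D K) \<and> nodes D K \<subseteq> check_set D K \<and> check_set D K \<subseteq> K"

text \<open>The Gauss--Lobatto rule with \<open>Q\<close> nodes is the rule that has both endpoints among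
  its nodes and is exact for polynomials of degree \<open>2 Q - 3\<close>.\<close>
definition gauss_lobatto :: "'d::finite scheme \<Rightarrow> nat \<Rightarrow> bool" where
  "gauss_lobatto D j \<longleftrightarrow> (let K = interval_cell D j in
     interface_pt D (j - 1) \<in> nodes D K \<and> interface_pt D j \<in> nodes D K
     \<and> (\<forall>g\<in>poly_space (2 * card (nodes D K) - 3).
          (\<Sum>x\<in>nodes D K. weight D K x * g x) = cell_avg K g))"

definition face_quadrature :: "'d::finite scheme \<Rightarrow> (real^'d) set \<Rightarrow> (real^'d) set \<Rightarrow> bool" where
  "face_quadrature D K e \<longleftrightarrow> finite (fnodes D e) \<and> fnodes D e \<subseteq> e
     \<and> (\<forall>q\<in>fnodes D e. fweight D e q > 0) \<and> (\<Sum>q\<in>fnodes D e. fweight D e q) = 1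
     \<and> (\<forall>g\<in>poly_space (deg D).
          (\<Sum>q\<in>fnodes D e. fweight D e q * g q) = face_avg (normal D K e) e g)
     \<and> fnodes D e \<subseteq> nodes D K"

definition discretisation :: "'d::finite scheme \<Rightarrow> bool" where
  "discretisation D \<longleftrightarrow>
     CARD('d) \<in> {1, 2, 3} \<and> coord_labelling (lab D)
     \<and> gam D > 1 \<and> num_ent D \<ge> 1
     \<and> (\<forall>r\<in>{1..num_ent D}. admissible_entropy_fun (gam D) (ent_fun D r))
     \<and> (\<forall>K\<in>cells D. cell_quadrature D K)
     \<and> (if CARD('d) = 1
        then uniform_mesh D \<and> (\<forall>j\<in>{1..num_cells D}. gauss_lobatto D j)
        else conforming_mesh D \<and> (\<forall>K\<in>cells D. \<forall>e\<in>faces D K. face_quadrature D K e))"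

subsection \<open>Traces and admissible fields\<close>

definition trace1_minus :: "'d::finite scheme \<Rightarrow> 'd dfield \<Rightarrow> nat \<Rightarrow> state" where
  "trace1_minus D U j = (let x = interface_pt D j in
     if j = 0 then snd U {x} x else fst U (interval_cell D j) x)"

definition trace1_plus :: "'d::finite scheme \<Rightarrow> 'd dfield \<Rightarrow> nat \<Rightarrow> state" where
  "trace1_plus D U j = (let x = interface_pt D j in
     if j = num_cells D then snd U {x} x else fst U (interval_cell D (j + 1)) x)"

definition is_neighbour :: "'d::finite scheme \<Rightarrow> (real^'d) set \<Rightarrow> (real^'d) set \<Rightarrow> (real^'d) set \<Rightarrow> bool"
  where
  "is_neighbour D K e K' \<longleftrightarrow> K' \<in> cells D \<and> K' \<noteq> K \<and> e \<in> faces D K'"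

definition exterior_trace ::
  "'d::finite scheme \<Rightarrow> 'd dfield \<Rightarrow> (real^'d) set \<Rightarrow> (real^'d) set \<Rightarrow> real^'d \<Rightarrow> state" where
  "exterior_trace D U K e q =
     (if \<exists>K'. is_neighbour D K e K' then fst U (THE K'. is_neighbour D K e K') q else snd U e q)"

text \<open>Divergence of the magnetic part of \<open>u\<close>, i.e. $\sum_{i=1}^d \partial_{x_i} B_i$.\<close>
definition div_mag :: "'d::finite scheme \<Rightarrow> (real^'d \<Rightarrow> state) \<Rightarrow> real^'d \<Rightarrow> real" where
  "div_mag D u x =
     (\<Sum>i\<in>UNIV. frechet_derivative (\<lambda>y. mag (u y) $ lab D i) (at x) (axis i 1))"

definition magnetic_constraint ::
  "'d::finite scheme \<Rightarrow> (real^'d) set \<Rightarrow> (real^'d \<Rightarrow> state) \<Rightarrow> bool" where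
  "magnetic_constraint D K u \<longleftrightarrow>
     (if CARD('d) = 1 then \<forall>x\<in>K. mag (u x) $ 1 = B_const D else \<forall>x\<in>K. div_mag D u x = 0)"

definition boundary_traces_ok :: "'d::finite scheme \<Rightarrow> 'd dfield \<Rightarrow> bool" where
  "boundary_traces_ok D U \<longleftrightarrow>
     (if CARD('d) = 1
      then \<forall>j\<in>{0, num_cells D}. let x = interface_pt D j; V = snd U {x} x in
             V \<in> Gset \<and> mag V $ 1 = B_const D
      else \<forall>K\<in>cells D. \<forall>e\<in>faces D K. \<forall>q\<in>fnodes D e.
             (\<nexists>K'. is_neighbour D K e K') \<longrightarrow> snd U e q \<in> Gset)"

definition admissible :: "'d::finite scheme \<Rightarrow> 'd dfield \<Rightarrow> bool" where
  "admissible D U \<longleftrightarrow>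
     (\<forall>K\<in>cells D. fst U K \<in> poly_space (deg D) \<and> (\<forall>x\<in>check_set D K. fst U K x \<in> Gset)
        \<and> magnetic_constraint D K (fst U K))
     \<and> boundary_traces_ok D U"

section \<open>Fluxes of a field, forward Euler property\<close>

text \<open>For \<open>d = 1\<close> the normal \<open>vec 1\<close> is the unit vector of the only coordinate.\<close>

definition num_flux1 :: "'d::finite scheme \<Rightarrow> 'd dfield \<Rightarrow> nat \<Rightarrow> state" where
  "num_flux1 D U j = hll_flux (gam D) (lab D) (vec 1) (speed1_minus D U j) (speed1_plus D U j)
     (trace1_minus D U j) (trace1_plus D U j)"

definition num_ent_flux1 :: "'d::finite scheme \<Rightarrow> nat \<Rightarrow> 'd dfield \<Rightarrow> nat \<Rightarrow> real" where
  "num_ent_flux1 D r U j = hll_ent_flux (gam D) (ent_fun D r) (lab D) (vec 1)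
     (speed1_minus D U j) (speed1_plus D U j) (trace1_minus D U j) (trace1_plus D U j)"

definition num_source_flux ::
  "'d::finite scheme \<Rightarrow> 'd dfield \<Rightarrow> (real^'d) set \<Rightarrow> (real^'d) set \<Rightarrow> real^'d \<Rightarrow> state" where
  "num_source_flux D U K e q = hll_source_flux (gam D) (lab D) (normal D K e)
     (speed_minus D U K e q) (speed_plus D U K e q) (fst U K q) (exterior_trace D U K e q)"

definition num_ent_flux ::
  "'d::finite scheme \<Rightarrow> nat \<Rightarrow> 'd dfield \<Rightarrow> (real^'d) set \<Rightarrow> (real^'d) set \<Rightarrow> real^'d \<Rightarrow> real" where
  "num_ent_flux D r U K e q = hll_ent_flux (gam D) (ent_fun D r) (lab D) (normal D K e)
     (speed_minus D U K e q) (speed_plus D U K e q) (fst U K q) (exterior_trace D U K e q)"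

definition face_points :: "'d::finite scheme \<Rightarrow> (real^'d) set \<Rightarrow> ((real^'d) set \<times> (real^'d)) set" where
  "face_points D K = Sigma (faces D K) (fnodes D)"

definition face_coeff :: "'d::finite scheme \<Rightarrow> (real^'d) set \<Rightarrow> (real^'d) set \<Rightarrow> real^'d \<Rightarrow> real" where
  "face_coeff D K e q = face_area (normal D K e) e * fweight D e q"

definition cell_index :: "'d::finite scheme \<Rightarrow> (real^'d) set \<Rightarrow> nat" where
  "cell_index D K = (THE j. j \<in> {1..num_cells D} \<and> K = interval_cell D j)"

text \<open>The net outflow of the numerical flux through the boundary of \<open>K\<close>.\<close>
definition net_flux :: "'d::finite scheme \<Rightarrow> (real^'d) set \<Rightarrow> 'd dfield \<Rightarrow> state" where
  "net_flux D K U =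
     (if CARD('d) = 1
      then num_flux1 D U (cell_index D K) - num_flux1 D U (cell_index D K - 1)
      else \<Sum>(e, q)\<in>face_points D K. face_coeff D K e q *\<^sub>R num_source_flux D U K e q)"

text \<open>$\mathcal{F}_{K,r}$\<close>
definition net_ent_flux :: "'d::finite scheme \<Rightarrow> (real^'d) set \<Rightarrow> nat \<Rightarrow> 'd dfield \<Rightarrow> real" where
  "net_ent_flux D K r U =
     (if CARD('d) = 1
      then num_ent_flux1 D r U (cell_index D K) - num_ent_flux1 D r U (cell_index D K - 1)
      else \<Sum>(e, q)\<in>face_points D K. face_coeff D K e q * num_ent_flux D r U K e q)"

text \<open>$\mathcal{S}_{K,r}$\<close>
definition quad_entropy :: "'d::finite scheme \<Rightarrow> (real^'d) set \<Rightarrow> nat \<Rightarrow> (real^'d \<Rightarrow> state) \<Rightarrow> real" where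
  "quad_entropy D K r u = (\<Sum>x\<in>nodes D K. weight D K x * entropy D r (u x))"

definition FE_update :: "'d::finite scheme \<Rightarrow> 'd dfield \<Rightarrow> real \<Rightarrow> 'd pfield" where
  "FE_update D U \<tau> = (\<lambda>K x. fst U K x + \<tau> *\<^sub>R residual D U K x)"

definition FE_budget :: "'d::finite scheme \<Rightarrow> (real^'d) set \<Rightarrow> nat \<Rightarrow> 'd dfield \<Rightarrow> real \<Rightarrow> real" where
  "FE_budget D K r U \<tau> = quad_entropy D K r (fst U K) - \<tau> / volume K * net_ent_flux D K r U"

text \<open>Signs of the wave speeds; one pair per interface point, shared by both cells.\<close>
definition wave_speeds_ok :: "'d::finite scheme \<Rightarrow> 'd dfield \<Rightarrow> bool" where
  "wave_speeds_ok D U \<longleftrightarrow>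
     (if CARD('d) = 1
      then \<forall>j\<le>num_cells D. speed1_minus D U j < 0 \<and> 0 < speed1_plus D U j
      else \<forall>K\<in>cells D. \<forall>e\<in>faces D K. \<forall>q\<in>fnodes D e.
             speed_minus D U K e q < 0 \<and> 0 < speed_plus D U K e q
             \<and> (\<forall>K'. is_neighbour D K e K' \<longrightarrow>
                  speed_minus D U K' e q = - speed_plus D U K e q
                  \<and> speed_plus D U K' e q = - speed_minus D U K e q))"

definition residual_ok :: "'d::finite scheme \<Rightarrow> 'd dfield \<Rightarrow> bool" where
  "residual_ok D U \<longleftrightarrow> (\<forall>K\<in>cells D.
     residual D U K \<in> poly_space (deg D)
     \<and> cell_avg K (residual D U K) = - (1 / volume K) *\<^sub>R net_flux D K U
     \<and> (if CARD('d) = 1 then \<forall>x\<in>K. mag (residual D U K x) $ 1 = 0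
        else \<forall>x\<in>K. div_mag D (residual D U K) x = 0))"

definition forward_Euler_property :: "'d::finite scheme \<Rightarrow> 'd dfield \<Rightarrow> bool" where
  "forward_Euler_property D U \<longleftrightarrow> tau_FE D U > 0 \<and>
     (\<forall>\<tau>. 0 \<le> \<tau> \<and> \<tau> \<le> tau_FE D U \<longrightarrow>
       (\<forall>K\<in>cells D. cell_avg K (FE_update D U \<tau> K) \<in> Gset
          \<and> (\<forall>r\<in>{1..num_ent D}.
               entropy D r (cell_avg K (FE_update D U \<tau> K)) \<le> FE_budget D K r U \<tau>)))"

definition standing_assumptions :: "'d::finite scheme \<Rightarrow> bool" where
  "standing_assumptions D \<longleftrightarrow> discretisation D \<and>
     (\<forall>U. admissible D U \<longrightarrow> wave_speeds_ok D U \<and> residual_ok D U \<and> forward_Euler_property D U)"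

section \<open>Multistep update\<close>

text \<open>\<open>V l\<close> stands for the field at time level \<open>n - l\<close>, and \<open>c l\<close>, \<open>d l\<close> for the
  coefficients, \<open>l < m\<close>. Terms with \<open>c l = 0\<close> are omitted.\<close>

definition multistep_update ::
  "'d::finite scheme \<Rightarrow> nat \<Rightarrow> (nat \<Rightarrow> real) \<Rightarrow> (nat \<Rightarrow> real) \<Rightarrow> real \<Rightarrow> (nat \<Rightarrow> 'd dfield) \<Rightarrow> 'd pfield"
  where
  "multistep_update D m c d \<Delta>t V = (\<lambda>K x.
     \<Sum>l | l < m \<and> c l > 0. c l *\<^sub>R FE_update D (V l) (d l / c l * \<Delta>t) K x)"

definition multistep_budget ::
  "'d::finite scheme \<Rightarrow> nat \<Rightarrow> (nat \<Rightarrow> real) \<Rightarrow> (nat \<Rightarrow> real) \<Rightarrow> real \<Rightarrow> (nat \<Rightarrow> 'd dfield)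
     \<Rightarrow> (real^'d) set \<Rightarrow> nat \<Rightarrow> real" where
  "multistep_budget D m c d \<Delta>t V K r =
     (\<Sum>l | l < m \<and> c l \<noteq> 0. c l * FE_budget D K r (V l) (d l / c l * \<Delta>t))"

section \<open>Weak-to-strong lifting\<close>

text \<open>\<open>u\<close> is the polynomial to be lifted, \<open>W\<close> its average, \<open>b r\<close> the entropy bounds.\<close>

definition Gset_eps :: "real \<Rightarrow> real \<Rightarrow> real \<Rightarrow> state set" where
  "Gset_eps \<gamma> \<epsilon>\<rho> \<epsilon>p = {U \<in> Gset. dens U \<ge> \<epsilon>\<rho> \<and> pres \<gamma> U \<ge> \<epsilon>p}"

definition scale_about :: "state \<Rightarrow> real \<Rightarrow> ('a \<Rightarrow> state) \<Rightarrow> 'a \<Rightarrow> state" where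
  "scale_about W \<theta> u = (\<lambda>x. W + \<theta> *\<^sub>R (u x - W))"

definition theta_PP ::
  "'d::finite scheme \<Rightarrow> (real^'d) set \<Rightarrow> real \<Rightarrow> real \<Rightarrow> state \<Rightarrow> (real^'d \<Rightarrow> state) \<Rightarrow> real" where
  "theta_PP D K \<epsilon>\<rho> \<epsilon>p W u = (GREATEST \<theta>. \<theta> \<in> {0..1} \<and>
     (\<forall>x\<in>check_set D K. scale_about W \<theta> u x \<in> Gset_eps (gam D) \<epsilon>\<rho> \<epsilon>p))"

definition entropy_profile ::
  "'d::finite scheme \<Rightarrow> (real^'d) set \<Rightarrow> real \<Rightarrow> real \<Rightarrow> state \<Rightarrow> (real^'d \<Rightarrow> state) \<Rightarrow> nat \<Rightarrow> real \<Rightarrow> real"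
  where
  "entropy_profile D K \<epsilon>\<rho> \<epsilon>p W u r \<theta> =
     quad_entropy D K r (scale_about W \<theta> (scale_about W (theta_PP D K \<epsilon>\<rho> \<epsilon>p W u) u))"

definition theta_ent ::
  "'d::finite scheme \<Rightarrow> (real^'d) set \<Rightarrow> real \<Rightarrow> real \<Rightarrow> state \<Rightarrow> (nat \<Rightarrow> real) \<Rightarrow> (real^'d \<Rightarrow> state)
     \<Rightarrow> nat \<Rightarrow> real" where
  "theta_ent D K \<epsilon>\<rho> \<epsilon>p W b u r =
     (if entropy_profile D K \<epsilon>\<rho> \<epsilon>p W u r 1 \<le> b r then 1
      else THE \<theta>. \<theta> \<in> {0..<1} \<and> entropy_profile D K \<epsilon>\<rho> \<epsilon>p W u r \<theta> = b r)"

definition lifted ::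
  "'d::finite scheme \<Rightarrow> (real^'d) set \<Rightarrow> real \<Rightarrow> real \<Rightarrow> state \<Rightarrow> (nat \<Rightarrow> real) \<Rightarrow> (real^'d \<Rightarrow> state)
     \<Rightarrow> real^'d \<Rightarrow> state" where
  "lifted D K \<epsilon>\<rho> \<epsilon>p W b u = scale_about W
     (theta_PP D K \<epsilon>\<rho> \<epsilon>p W u * Min (theta_ent D K \<epsilon>\<rho> \<epsilon>p W b u ` {1..num_ent D})) u"

end

theory Submission
  imports Defs
begin

text \<open>
  The internal energy \<open>int_ener\<close> is a concave function of the state, and \<open>\<eta>\<close> is a strictly convex function of
  \<open>(\<rho>, int_ener)\<close> that decreases strictly in \<open>int_ener\<close>; hence \<open>\<G>\<close> is convex and \<open>\<eta>\<close> is strictly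
  convex on it. The multistep update is a convex combination of forward Euler updates with
  admissible step sizes, so Jensen's inequality gives the bounds on its averages. Along the segment
  from the average to the limited polynomial, the nodal entropy has its minimum at the average by
  Jensen's inequality, so strict convexity makes it either constant or strictly increasing. This is
  what makes the root in the definition of \<open>\<vartheta>\<close> unique, and it lets one pass to the minimum of the
  roots over \<open>r\<close>.
\<close>

section \<open>Convexity of the entropies\<close>

lemma dens_simps [simp]:
  "dens (U + V) = dens U + dens V" "dens (U - V) = dens U - dens V" "dens (a *\<^sub>R U) = a * dens U"
  by (simp_all add: dens_def)

lemma mom_simps [simp]:
  "mom (U + V) = mom U + mom V" "mom (U - V) = mom U - mom V" "mom (a *\<^sub>R U) = a *\<^sub>R mom U"
  by (simp_all add: mom_def)

lemma mag_simps [simp]: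
  "mag (U + V) = mag U + mag V" "mag (U - V) = mag U - mag V" "mag (a *\<^sub>R U) = a *\<^sub>R mag U"
  by (simp_all add: mag_def)

lemma ener_simps [simp]:
  "ener (U + V) = ener U + ener V" "ener (U - V) = ener U - ener V" "ener (a *\<^sub>R U) = a * ener U"
  by (simp_all add: ener_def)

lemma state_eqI:
  "dens U = dens V \<Longrightarrow> mom U = mom V \<Longrightarrow> mag U = mag V \<Longrightarrow> ener U = ener V \<Longrightarrow> U = V"
  by (simp add: dens_def mom_def mag_def ener_def prod_eq_iff)

text \<open>Decomposition of a weighted two-point second moment into mean and variance. The exact
  defect is kept, since strictness is needed later. The weights will be masses for the velocities,
  and \<open>1 - t\<close>, \<open>t\<close> for the magnetic fields.\<close>

lemma norm_sq_convex_defect: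
  fixes v w :: "'a::real_inner"
  assumes "\<alpha> > 0" "\<beta> > 0"
  shows "\<alpha> * (norm v)\<^sup>2 + \<beta> * (norm w)\<^sup>2
    = (norm (\<alpha> *\<^sub>R v + \<beta> *\<^sub>R w))\<^sup>2 / (\<alpha> + \<beta>) + \<alpha> * \<beta> / (\<alpha> + \<beta>) * (norm (v - w))\<^sup>2"
proof -
  have "\<alpha> + \<beta> \<noteq> 0" using assms by simp
  then have "\<alpha> * (norm v)\<^sup>2 + \<beta> * (norm w)\<^sup>2
    = ((norm (\<alpha> *\<^sub>R v + \<beta> *\<^sub>R w))\<^sup>2 + \<alpha> * \<beta> * (norm (v - w))\<^sup>2) / (\<alpha> + \<beta>)"
    by (simp add: power2_norm_eq_inner inner_simps inner_commute eq_divide_eq algebra_simps)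
  then show ?thesis by (simp add: add_divide_distrib)
qed

text \<open>With \<open>mom U = dens U *\<^sub>R vel U\<close>, the kinetic energy is a second
  moment of the velocities with mass weights \<alpha> and \<beta>. The two defects are the energies
  lost by averaging velocities and magnetic fields.\<close>

lemma int_ener_convex_combination:
  assumes "dens U > 0" "dens V > 0" "0 < t" "t < 1"
  defines "\<alpha> \<equiv> (1 - t) * dens U" and "\<beta> \<equiv> t * dens V"
  shows "int_ener ((1 - t) *\<^sub>R U + t *\<^sub>R V) = (1 - t) * int_ener U + t * int_ener V
    + \<alpha> * \<beta> / (2 * (\<alpha> + \<beta>)) * (norm (vel U - vel V))\<^sup>2
    + (1 - t) * t / 2 * (norm (mag U - mag V))\<^sup>2"
proof -
  have pos: "\<alpha> > 0" "\<beta> > 0" using assms by (simp_all add: \<alpha>_def \<beta>_def)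
  have m: "mom U = dens U *\<^sub>R vel U" "mom V = dens V *\<^sub>R vel V"
    using assms by (simp_all add: vel_def)
  have 1: "(norm ((1 - t) *\<^sub>R mom U + t *\<^sub>R mom V))\<^sup>2 / (\<alpha> + \<beta>)
      = \<alpha> * (norm (vel U))\<^sup>2 + \<beta> * (norm (vel V))\<^sup>2
        - \<alpha> * \<beta> / (\<alpha> + \<beta>) * (norm (vel U - vel V))\<^sup>2"
    using norm_sq_convex_defect[OF pos, of "vel U" "vel V"] by (simp add: m \<alpha>_def \<beta>_def)
  have 2: "(norm (mom U))\<^sup>2 / dens U = dens U * (norm (vel U))\<^sup>2"
    "(norm (mom V))\<^sup>2 / dens V = dens V * (norm (vel V))\<^sup>2"
    using assms(1,2) by (simp_all add: m power_mult_distrib power2_eq_square)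
  have 3: "(norm ((1 - t) *\<^sub>R mag U + t *\<^sub>R mag V))\<^sup>2
      = (1 - t) * (norm (mag U))\<^sup>2 + t * (norm (mag V))\<^sup>2 - (1 - t) * t * (norm (mag U - mag V))\<^sup>2"
    using norm_sq_convex_defect[of "1 - t" t "mag U" "mag V"] assms(3,4) by simp
  have e: "int_ener X = ener X - ((norm (mom X))\<^sup>2 / dens X) / 2 - (norm (mag X))\<^sup>2 / 2" for X
    by (simp add: int_ener_def)
  \<comment> \<open>\<open>Q\<close> hides the quotient by \<alpha> + \<beta>, so that the final
    simplification meets only numerical denominators.\<close>
  define Q where "Q = \<alpha> * \<beta> / (\<alpha> + \<beta>) * (norm (vel U - vel V))\<^sup>2"
  have Q: "\<alpha> * \<beta> / (2 * (\<alpha> + \<beta>)) * (norm (vel U - vel V))\<^sup>2 = Q / 2"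
    by (simp add: Q_def)
  show ?thesis
    unfolding Q
    unfolding e dens_simps mom_simps mag_simps ener_simps \<alpha>_def[symmetric] \<beta>_def[symmetric]
      1[folded Q_def] 2 3
    by (simp add: \<alpha>_def \<beta>_def field_simps)
qed

lemma int_ener_concave:
  assumes "dens U > 0" "dens V > 0" "0 < t" "t < 1"
  shows "(1 - t) * int_ener U + t * int_ener V \<le> int_ener ((1 - t) *\<^sub>R U + t *\<^sub>R V)"
  unfolding int_ener_convex_combination[OF assms] using assms by simp

text \<open>Both nonnegative defects have positive coefficients for 0 < t < 1, so either difference
  suffices.\<close>

lemma int_ener_strict_concave:
  assumes "dens U > 0" "dens V > 0" "0 < t" "t < 1" "vel U \<noteq> vel V \<or> mag U \<noteq> mag V"
  shows "(1 - t) * int_ener U + t * int_ener V < int_ener ((1 - t) *\<^sub>R U + t *\<^sub>R V)"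
proof -
  have "0 < (1 - t) * dens U * (t * dens V) / (2 * ((1 - t) * dens U + t * dens V))"
    using assms by (simp add: add_pos_pos)
  then show ?thesis
    unfolding int_ener_convex_combination[OF assms(1-4)] using assms
    by (smt (verit, best) mult_pos_pos mult_nonneg_nonneg zero_less_norm_iff zero_less_power
        zero_le_power2 half_gt_zero right_minus_eq)
qed

text \<open>Positive density is a linear condition, and within it \<open>Gset\<close> is a
  superlevel set of the concave \<open>int_ener\<close>.\<close>

lemma convex_Gset: "convex Gset"
  unfolding convex_alt
proof (intro ballI allI impI)
  fix U V :: state and t :: real
  assume U: "U \<in> Gset" and V: "V \<in> Gset" and t: "0 \<le> t \<and> t \<le> 1"
  show "(1 - t) *\<^sub>R U + t *\<^sub>R V \<in> Gset"
  proof (cases "t = 0 \<or> t = 1")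
    case True
    then show ?thesis using U V by auto
  next
    case False
    then have t': "0 < t" "t < 1" using t by auto
    have "0 < (1 - t) * int_ener U + t * int_ener V"
      using U V t' by (auto simp: Gset_def intro!: add_pos_pos)
    also have "\<dots> \<le> int_ener ((1 - t) *\<^sub>R U + t *\<^sub>R V)"
      using U V t' by (intro int_ener_concave) (auto simp: Gset_def)
    finally show ?thesis
      using U V t' by (auto simp: Gset_def intro!: add_pos_pos)
  qed
qed

section \<open>The entropy as a function of density and internal energy per unit volume\<close>

definition thermo_entropy :: "real \<Rightarrow> (real \<Rightarrow> real) \<Rightarrow> real \<Rightarrow> real \<Rightarrow> real" where
  "thermo_entropy \<gamma> f \<rho> e = - \<rho> * f (ln ((\<gamma> - 1) * e) - \<gamma> * ln \<rho>)"

text \<open>Momentum and magnetic field enter only through \<open>int_ener\<close>; convexity of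
  \<open>eta\<close> thus splits into a two-variable question and the concavity of
  \<open>int_ener\<close>.\<close>

lemma eta_eq_thermo_entropy: "eta \<gamma> f U = thermo_entropy \<gamma> f (dens U) (int_ener U)"
  by (simp add: eta_def thermo_entropy_def spec_entropy_def pres_def)

lemma admissible_entropy_fun_derivs:
  assumes "admissible_entropy_fun \<gamma> f"
  shows "(f has_real_derivative deriv f s) (at s)"
    and "(deriv f has_real_derivative deriv (deriv f) s) (at s)"
    and "deriv f s > 0" and "deriv f s - \<gamma> * deriv (deriv f) s > 0"
  using assms
  by (auto simp: admissible_entropy_fun_def C2_def differentiable_on_def field_differentiable_def
      real_differentiable_def intro!: DERIV_imp_deriv DERIV_deriv_iff_real_differentiable[THEN iffD2])

lemma thermo_entropy_strict_antimono:
  assumes f: "admissible_entropy_fun \<gamma> f" and "\<gamma> > 1" "\<rho> > 0" "0 < e" "e < e'"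
  shows "thermo_entropy \<gamma> f \<rho> e' < thermo_entropy \<gamma> f \<rho> e"
proof -
  have "f x < f y" if "x < y" for x y
    using DERIV_pos_imp_increasing[of x y f] that admissible_entropy_fun_derivs[OF f] by blast
  moreover have "ln ((\<gamma> - 1) * e) < ln ((\<gamma> - 1) * e')"
    using assms by (subst ln_less_cancel_iff) auto
  ultimately show ?thesis
    using assms by (simp add: thermo_entropy_def)
qed

text \<open>By the mean value theorem the chord slopes on the two sides of t are values of g' at
  points a < t < b, and g' increases strictly. Derivatives are asked for on [0,1] only, because
  density and energy may lose their sign beyond the segment.\<close>

lemma second_derivative_pos_strict_convex:
  fixes g :: "real \<Rightarrow> real"
  assumes g: "\<And>x. 0 \<le> x \<Longrightarrow> x \<le> 1 \<Longrightarrow> (g has_real_derivative g' x) (at x)"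
    and g': "\<And>x. 0 \<le> x \<Longrightarrow> x \<le> 1 \<Longrightarrow> (g' has_real_derivative g'' x) (at x)"
    and pos: "\<And>x. 0 \<le> x \<Longrightarrow> x \<le> 1 \<Longrightarrow> g'' x > 0"
    and t: "0 < t" "t < 1"
  shows "g t < (1 - t) * g 0 + t * g 1"
proof -
  obtain a where a: "0 < a" "a < t" "g t - g 0 = (t - 0) * g' a"
    using MVT2[of 0 t g g'] g t by auto
  obtain b where b: "t < b" "b < 1" "g 1 - g t = (1 - t) * g' b"
    using MVT2[of t 1 g g'] g t by auto
  have "g' a < g' b"
  proof (rule DERIV_pos_imp_increasing[of a b g'])
    fix x assume "a \<le> x" "x \<le> b"
    then show "\<exists>y. (g' has_real_derivative y) (at x) \<and> 0 < y"
      using g'[of x] pos[of x] a b by auto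
  qed (use a b in simp)
  then have "t * (1 - t) * g' a < t * (1 - t) * g' b" using t by simp
  moreover have "(1 - t) * (g t - g 0) = t * (1 - t) * g' a"
    "t * (g 1 - g t) = t * (1 - t) * g' b" using a b by simp_all
  ultimately show ?thesis by (simp add: algebra_simps)
qed

text \<open>Restriction to the segment reduces the claim to a positive second derivative in one
  variable.\<close>

lemma thermo_entropy_strict_convex:
  assumes f: "admissible_entropy_fun \<gamma> f" and \<gamma>: "\<gamma> > 1"
    and pos: "\<rho> > 0" "\<rho>' > 0" "e > 0" "e' > 0"
    and ne: "\<rho> \<noteq> \<rho>' \<or> e \<noteq> e'" and t: "0 < t" "t < 1"
  shows "thermo_entropy \<gamma> f ((1 - t) * \<rho> + t * \<rho>') ((1 - t) * e + t * e')
    < (1 - t) * thermo_entropy \<gamma> f \<rho> e + t * thermo_entropy \<gamma> f \<rho>' e'"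
proof -
  \<comment> \<open>\<open>R\<close>, \<open>E\<close>, \<open>S\<close> are density, internal
    energy and specific entropy along the segment, \<open>g\<close> is the entropy there; the
    suffixes 1 and 2 mark first and second derivatives.\<close>
  define a b where "a = \<rho>' - \<rho>" and "b = e' - e"
  define R E where "R x = \<rho> + x * a" and "E x = e + x * b" for x
  define S S1 where "S x = ln ((\<gamma> - 1) * E x) - \<gamma> * ln (R x)"
    and "S1 x = b / E x - \<gamma> * (a / R x)" for x
  define S2 where "S2 x = - (b / E x)\<^sup>2 + \<gamma> * (a / R x)\<^sup>2" for x
  define f1 f2 where "f1 = deriv f" and "f2 = deriv (deriv f)"
  note df = admissible_entropy_fun_derivs[OF f, folded f1_def f2_def]
  define g g1 where "g x = - R x * f (S x)"
    and "g1 x = - a * f (S x) - R x * (f1 (S x) * S1 x)" for x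
  define g2 where "g2 x = - 2 * a * (f1 (S x) * S1 x)
    - R x * (f2 (S x) * (S1 x)\<^sup>2 + f1 (S x) * S2 x)" for x
  have R: "R x > 0" and E: "E x > 0" if "0 \<le> x" "x \<le> 1" for x
  proof -
    have "R x = (1 - x) * \<rho> + x * \<rho>'" "E x = (1 - x) * e + x * e'"
      by (simp_all add: R_def E_def a_def b_def algebra_simps)
    then show "R x > 0" "E x > 0" using that pos
      by (cases "x = 0"; auto intro!: add_nonneg_pos)+
  qed
  have dR: "(R has_real_derivative a) (at x)" and dE: "(E has_real_derivative b) (at x)" for x
    unfolding R_def E_def by (auto intro!: derivative_eq_intros)
  have dS: "(S has_real_derivative S1 x) (at x)" if "0 \<le> x" "x \<le> 1" for x
    unfolding S_def S1_def using R[OF that] E[OF that] \<gamma>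
    by (auto intro!: derivative_eq_intros dR dE simp: field_simps)
  have dS1: "(S1 has_real_derivative S2 x) (at x)" if "0 \<le> x" "x \<le> 1" for x
    unfolding S1_def S2_def using R[OF that] E[OF that]
    by (auto intro!: derivative_eq_intros dR dE simp: power2_eq_square)
  have dg: "(g has_real_derivative g1 x) (at x)" if "0 \<le> x" "x \<le> 1" for x
    unfolding g_def g1_def
    by (auto intro!: derivative_eq_intros dR DERIV_chain2[OF df(1)] dS[OF that])
  have dg1: "(g1 has_real_derivative g2 x) (at x)" if "0 \<le> x" "x \<le> 1" for x
    unfolding g1_def g2_def
    by (auto intro!: derivative_eq_intros dR DERIV_chain2[OF df(1)] DERIV_chain2[OF df(2)]
        dS[OF that] dS1[OF that] simp: algebra_simps power2_eq_square)
  have "g2 x > 0" if "0 \<le> x" "x \<le> 1" for x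
  proof -
    \<comment> \<open>In the relative rates of change \<open>X\<close> and \<open>Y\<close>,
      \<open>g2 x / R x\<close> is a quadratic form with coefficients built from \<open>p\<close>,
      \<open>q\<close> and \<gamma>.\<close>
    define X Y where "X = a / R x" and "Y = b / E x"
    define p q where "p = f1 (S x)" and "q = f2 (S x)"
    have pq: "p > 0" "p - \<gamma> * q > 0" using df(3,4) by (auto simp: p_def q_def)
    have "X \<noteq> 0 \<or> Y \<noteq> 0" using ne R[OF that] E[OF that] by (auto simp: X_def Y_def a_def b_def)
    have "S1 x = Y - \<gamma> * X" "S2 x = - Y\<^sup>2 + \<gamma> * X\<^sup>2" "a = R x * X"
      using R[OF that] by (simp_all add: S1_def S2_def X_def Y_def)
    then have g2_eq: "g2 x = - 2 * (R x * X) * (p * (Y - \<gamma> * X))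
        - R x * (q * (Y - \<gamma> * X)\<^sup>2 + p * (- Y\<^sup>2 + \<gamma> * X\<^sup>2))"
      unfolding g2_def p_def q_def by presburger
    \<comment> \<open>The two hypotheses \<open>f' > 0\<close> and \<open>f' - \<gamma> f'' > 0\<close> are the weights of a sum of squares.\<close>
    have "\<gamma> * g2 x = R x * ((\<gamma> - 1) * p * Y\<^sup>2 + (p - \<gamma> * q) * (Y - \<gamma> * X)\<^sup>2)"
      unfolding g2_eq by (simp add: algebra_simps power2_eq_square)
    moreover have "(\<gamma> - 1) * p * Y\<^sup>2 + (p - \<gamma> * q) * (Y - \<gamma> * X)\<^sup>2 > 0"
    \<comment> \<open>If \<open>Y = 0\<close>, then \<open>X\<close> is nonzero and the second
      square is positive; otherwise the first one is.\<close>
    proof (cases "Y = 0")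
      case True
      then show ?thesis using \<open>X \<noteq> 0 \<or> Y \<noteq> 0\<close> pq \<gamma> by simp
    next
      case False
      then show ?thesis using pq \<gamma> by (intro add_pos_nonneg) auto
    qed
    ultimately have "\<gamma> * g2 x > 0" using R[OF that] by simp
    then show ?thesis using \<gamma> by (simp add: zero_less_mult_iff)
  qed
  then have "g t < (1 - t) * g 0 + t * g 1"
    using second_derivative_pos_strict_convex[of g g1 g2 t] dg dg1 t by blast
  moreover have "g x = thermo_entropy \<gamma> f ((1 - x) * \<rho> + x * \<rho>') ((1 - x) * e + x * e')" for x
    unfolding g_def thermo_entropy_def S_def R_def E_def a_def b_def by (simp add: algebra_simps)
  ultimately show ?thesis by simp
qed

text \<open>Strictness has two sources. If density or internal energy differ, it comes from
  \<open>thermo_entropy\<close>. If both agree, distinct states differ in velocity or magnetic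
  field, so \<open>int_ener\<close> is strictly concave between them and the entropy strictly
  decreasing in it gives the gap.\<close>

lemma eta_strict_convex:
  assumes f: "admissible_entropy_fun \<gamma> f" and \<gamma>: "\<gamma> > 1"
    and U: "U \<in> Gset" and V: "V \<in> Gset" and ne: "U \<noteq> V" and t: "0 < t" "t < 1"
  shows "eta \<gamma> f ((1 - t) *\<^sub>R U + t *\<^sub>R V) < (1 - t) * eta \<gamma> f U + t * eta \<gamma> f V"
proof -
  let ?\<rho> = "(1 - t) * dens U + t * dens V" and ?e = "(1 - t) * int_ener U + t * int_ener V"
  let ?w = "(1 - t) *\<^sub>R U + t *\<^sub>R V"
  have pos: "dens U > 0" "dens V > 0" "int_ener U > 0" "int_ener V > 0"
    using U V by (auto simp: Gset_def)
  have rpos: "?\<rho> > 0" and epos: "?e > 0" using pos t by (auto intro!: add_pos_pos)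
  have le: "?e \<le> int_ener ?w" using int_ener_concave pos t by blast
  have anti: "thermo_entropy \<gamma> f ?\<rho> (int_ener ?w) \<le> thermo_entropy \<gamma> f ?\<rho> ?e"
    using thermo_entropy_strict_antimono[OF f \<gamma> rpos epos] le
    by (metis order_le_less)
  show ?thesis
  proof (cases "dens U = dens V \<and> int_ener U = int_ener V")
    case False
    then have "thermo_entropy \<gamma> f ?\<rho> ?e
      < (1 - t) * thermo_entropy \<gamma> f (dens U) (int_ener U)
        + t * thermo_entropy \<gamma> f (dens V) (int_ener V)"
      using thermo_entropy_strict_convex[OF f \<gamma> pos _ t] by blast
    then show ?thesis using anti by (simp add: eta_eq_thermo_entropy)
  next
    case True
    \<comment> \<open>If these agreed too, the total energies would agree and the states would
      coincide.\<close>
    have "vel U \<noteq> vel V \<or> mag U \<noteq> mag V"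
    proof (rule ccontr)
      assume *: "\<not> ?thesis"
      then have "mom U = mom V" using True pos by (simp add: vel_def)
      moreover from this have "ener U = ener V" using * True unfolding int_ener_def by force
      ultimately show False using * True ne state_eqI by blast
    qed
    then have "?e < int_ener ?w" using int_ener_strict_concave pos t by blast
    then have "thermo_entropy \<gamma> f ?\<rho> (int_ener ?w) < thermo_entropy \<gamma> f ?\<rho> ?e"
      by (rule thermo_entropy_strict_antimono[OF f \<gamma> rpos epos])
    moreover have "?\<rho> = dens U" "?e = int_ener U" using True by (simp_all add: algebra_simps)
    ultimately show ?thesis
      using True by (simp add: eta_eq_thermo_entropy algebra_simps)
  qed
qed

lemma convex_on_eta:
  assumes "admissible_entropy_fun \<gamma> f" "\<gamma> > 1"
  shows "convex_on Gset (eta \<gamma> f)"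
proof (rule convex_onI)
  fix t U V assume "0 < (t::real)" "t < 1" "U \<in> Gset" "V \<in> Gset"
  then show "eta \<gamma> f ((1 - t) *\<^sub>R U + t *\<^sub>R V) \<le> (1 - t) * eta \<gamma> f U + t * eta \<gamma> f V"
    using eta_strict_convex[OF assms, of U V t]
    by (cases "U = V") (auto simp: algebra_simps simp flip: scaleR_add_left)
qed (rule convex_Gset)

section \<open>Polynomials, averages, magnetic constraint\<close>

lemma poly_space_linear_image:
  assumes "linear L" "g \<in> poly_space k"
  shows "(\<lambda>x. L (g x)) \<in> poly_space k"
proof -
  obtain c where "\<And>x. g x = (\<Sum>\<alpha> | sum \<alpha> UNIV \<le> k. (\<Prod>i\<in>UNIV. (x $ i) ^ \<alpha> i) *\<^sub>R c \<alpha>)"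
    using assms(2) by (auto simp: poly_space_def)
  then have "L (g x) = (\<Sum>\<alpha> | sum \<alpha> UNIV \<le> k. (\<Prod>i\<in>UNIV. (x $ i) ^ \<alpha> i) *\<^sub>R L (c \<alpha>))" for x
    using assms(1) by (simp add: linear_sum linear_scale)
  then show ?thesis unfolding poly_space_def by (auto intro!: exI[of _ "\<lambda>\<alpha>. L (c \<alpha>)"])
qed

text \<open>The coefficients are supported at the zero multi-index, whose monomial is 1 everywhere,
  as \<open>0 ^ 0 = 1\<close>.\<close>

lemma poly_space_const: "(\<lambda>x::real^'d::finite. a) \<in> poly_space k"
proof -
  have 1: "(\<Prod>i\<in>UNIV. (x $ i) ^ \<alpha> i) *\<^sub>R (if \<alpha> = (\<lambda>_. 0) then a else 0)
      = (if \<alpha> = (\<lambda>_. 0) then a else 0)"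
    for x :: "real^'d" and \<alpha>
    by simp
  have "a = (\<Sum>\<alpha> | sum \<alpha> UNIV \<le> k.
      (\<Prod>i\<in>UNIV. (x $ i) ^ \<alpha> i) *\<^sub>R (if \<alpha> = (\<lambda>_. 0) then a else 0))" for x :: "real^'d"
    unfolding 1 by (subst sum.delta) (simp_all add: finite_multi_indices)
  then show ?thesis
    unfolding poly_space_def
    by (intro CollectI exI[of _ "\<lambda>\<alpha>. if \<alpha> = (\<lambda>_. 0) then a else 0"] allI)
qed

lemma poly_space_add:
  assumes "g \<in> poly_space k" "h \<in> poly_space k"
  shows "(\<lambda>x. g x + h x) \<in> poly_space k"
proof -
  obtain c c' where "\<And>x. g x = (\<Sum>\<alpha> | sum \<alpha> UNIV \<le> k. (\<Prod>i\<in>UNIV. (x $ i) ^ \<alpha> i) *\<^sub>R c \<alpha>)"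
    "\<And>x. h x = (\<Sum>\<alpha> | sum \<alpha> UNIV \<le> k. (\<Prod>i\<in>UNIV. (x $ i) ^ \<alpha> i) *\<^sub>R c' \<alpha>)"
    using assms by (auto simp: poly_space_def)
  then show ?thesis
    unfolding poly_space_def
    by (auto intro!: exI[of _ "\<lambda>\<alpha>. c \<alpha> + c' \<alpha>"] simp: scaleR_add_right sum.distrib)
qed

lemma poly_space_scaleR: "g \<in> poly_space k \<Longrightarrow> (\<lambda>x. t *\<^sub>R g x) \<in> poly_space k"
  by (rule poly_space_linear_image) (auto simp: linear_iff algebra_simps)

lemma poly_space_sum:
  assumes "\<And>l. l \<in> A \<Longrightarrow> g l \<in> poly_space k"
  shows "(\<lambda>x. \<Sum>l\<in>A. g l x) \<in> poly_space k"
proof (cases "finite A")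
  case True
  then show ?thesis using assms
    by (induction A rule: finite_induct) (auto simp: poly_space_const poly_space_add)
qed (simp add: poly_space_const)

lemma poly_space_differentiable:
  fixes g :: "real^'d::finite \<Rightarrow> 'b::real_normed_vector"
  assumes "g \<in> poly_space k"
  shows "g differentiable (at x)"
proof -
  obtain c where g: "g = (\<lambda>x. \<Sum>\<alpha> | sum \<alpha> UNIV \<le> k. (\<Prod>i\<in>UNIV. (x $ i) ^ \<alpha> i) *\<^sub>R c \<alpha>)"
    using assms by (auto simp: poly_space_def)
  have "(\<lambda>x::real^'d. x $ i) differentiable (at x)" for i
    by (intro bounded_linear_imp_differentiable bounded_linear_vec_nth)
  then have pow: "(\<lambda>x::real^'d. (x $ i) ^ a) differentiable (at x)" for i a
    by (intro differentiable_power)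
  have "(\<lambda>x::real^'d. \<Prod>i\<in>I. (x $ i) ^ \<alpha> i) differentiable (at x)" if "finite I" for I \<alpha>
    using that by (induction I rule: finite_induct) (auto intro!: differentiable_mult pow)
  then show ?thesis
    unfolding g by (intro differentiable_sum differentiable_scaleR finite_multi_indices) auto
qed

lemma poly_space_continuous_on:
  fixes g :: "real^'d::finite \<Rightarrow> 'b::real_normed_vector"
  shows "g \<in> poly_space k \<Longrightarrow> continuous_on A g"
  by (meson continuous_at_imp_continuous_on differentiable_imp_continuous_within
      poly_space_differentiable)

section \<open>Cell averages and exact quadrature\<close>

lemma continuous_on_compact_integrable:
  fixes g :: "'a::euclidean_space \<Rightarrow> 'b::euclidean_space"
  assumes "compact K" "continuous_on K g"
  shows "g integrable_on K"
  using borel_integrable_compact[OF assms]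
    set_borel_integral_eq_integral(1)[of K g] by (simp add: set_integrable_def)

lemma poly_space_integrable:
  fixes g :: "real^'d::finite \<Rightarrow> 'b::euclidean_space"
  shows "compact K \<Longrightarrow> g \<in> poly_space k \<Longrightarrow> g integrable_on K"
  by (intro continuous_on_compact_integrable poly_space_continuous_on)

lemma cell_avg_linear:
  assumes "bounded_linear L" "g integrable_on K"
  shows "cell_avg K (\<lambda>x. L (g x)) = L (cell_avg K g)"
  using integral_linear[OF assms(2,1)] assms(1)
  by (simp add: cell_avg_def linear_simps comp_def)

lemma cell_avg_add:
  "g integrable_on K \<Longrightarrow> h integrable_on K
    \<Longrightarrow> cell_avg K (\<lambda>x. g x + h x) = cell_avg K g + cell_avg K h"
  by (simp add: cell_avg_def integral_add scaleR_add_right)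

lemma cell_avg_scaleR: "cell_avg K (\<lambda>x. t *\<^sub>R g x) = t *\<^sub>R cell_avg K g"
  by (simp add: cell_avg_def)

lemma cell_avg_sum:
  assumes "finite A" "\<And>l. l \<in> A \<Longrightarrow> g l integrable_on K"
  shows "cell_avg K (\<lambda>x. \<Sum>l\<in>A. g l x) = (\<Sum>l\<in>A. cell_avg K (g l))"
  using assms by (simp add: cell_avg_def integral_sum scaleR_sum_right)

text \<open>Compactness makes polynomials integrable over the cell, as additivity of
  \<open>cell_avg\<close> requires.\<close>

lemma cells_compact:
  fixes D :: "'d::finite scheme"
  assumes "discretisation D" "K \<in> cells D"
  shows "compact K"
proof (cases "CARD('d) = 1")
  case True
  then have "uniform_mesh D" using assms by (simp add: discretisation_def)
  then show ?thesis using assms(2) by (auto simp: uniform_mesh_def interval_cell_def)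
next
  case False
  then have "conforming_mesh D" using assms by (simp add: discretisation_def)
  then have "general_polytope K"
    using assms(2) by (simp add: conforming_mesh_def polytopal_cell_def)
  then show ?thesis
    by (metis general_polytope_def compact_Union polytope_imp_compact)
qed

text \<open>Exactness is assumed for real polynomials; it transfers coordinate by
  coordinate.\<close>

lemma quadrature_exact:
  fixes g :: "real^'d::finite \<Rightarrow> 'b::euclidean_space"
  assumes quad: "cell_quadrature D K" and K: "compact K" and g: "g \<in> poly_space (deg D)"
  shows "(\<Sum>x\<in>nodes D K. weight D K x *\<^sub>R g x) = cell_avg K g"
proof (rule euclidean_eqI)
  fix b :: 'b assume "b \<in> Basis"
  have "(\<Sum>x\<in>nodes D K. weight D K x *\<^sub>R g x) \<bullet> b = (\<Sum>x\<in>nodes D K. weight D K x * (g x \<bullet> b))"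
    by (simp add: inner_sum_left)
  also have "(\<lambda>x. g x \<bullet> b) \<in> poly_space (deg D)"
    using poly_space_linear_image[OF bounded_linear.linear[OF bounded_linear_inner_left] g] .
  then have "(\<Sum>x\<in>nodes D K. weight D K x * (g x \<bullet> b)) = cell_avg K (\<lambda>x. g x \<bullet> b)"
    using quad by (simp add: cell_quadrature_def)
  also have "\<dots> = cell_avg K g \<bullet> b"
    by (rule cell_avg_linear[OF bounded_linear_inner_left poly_space_integrable[OF K g]])
  finally show "(\<Sum>x\<in>nodes D K. weight D K x *\<^sub>R g x) \<bullet> b = cell_avg K g \<bullet> b" .
qed

text \<open>Exactness on constants and weights summing to 1 replace a computation with the
  volume.\<close>

lemma cell_avg_const:
  fixes a :: "'b::euclidean_space"
  assumes "cell_quadrature D K" "compact K"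
  shows "cell_avg K (\<lambda>x. a) = a"
  using quadrature_exact[OF assms poly_space_const, of a] assms(1)
  by (simp add: cell_quadrature_def flip: scaleR_sum_left)

section \<open>Contraction towards the cell average\<close>

lemma scale_about_eq: "scale_about W \<theta> u = (\<lambda>x. (1 - \<theta>) *\<^sub>R W + \<theta> *\<^sub>R u x)"
  by (simp add: scale_about_def fun_eq_iff algebra_simps)

text \<open>Merges the positivity and entropy stages into the single contraction of
  \<open>lifted\<close>.\<close>

lemma scale_about_scale_about:
  "scale_about W \<theta> (scale_about W \<theta>' u) = scale_about W (\<theta> * \<theta>') u"
  by (simp add: scale_about_def)

lemma poly_space_scale_about: "u \<in> poly_space k \<Longrightarrow> scale_about W \<theta> u \<in> poly_space k"
  unfolding scale_about_eq by (intro poly_space_add poly_space_scaleR poly_space_const)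

lemma cell_avg_scale_about:
  assumes "cell_quadrature D K" "compact K" "u \<in> poly_space (deg D)" "W = cell_avg K u"
  shows "cell_avg K (scale_about W \<theta> u) = W"
proof -
  have "cell_avg K (scale_about W \<theta> u) = cell_avg K (\<lambda>x. (1 - \<theta>) *\<^sub>R W) + cell_avg K (\<lambda>x. \<theta> *\<^sub>R u x)"
    unfolding scale_about_eq
    by (intro cell_avg_add poly_space_integrable[OF assms(2), of _ "deg D"] poly_space_scaleR
        poly_space_const assms)
  also have "\<dots> = W"
    unfolding cell_avg_const[OF assms(1,2)] cell_avg_scaleR assms(4) by (simp add: algebra_simps)
  finally show ?thesis .
qed

lemma poly_space_FE_update:
  "fst U K \<in> poly_space k \<Longrightarrow> residual D U K \<in> poly_space k \<Longrightarrow> FE_update D U \<tau> K \<in> poly_space k"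
  unfolding FE_update_def by (intro poly_space_add poly_space_scaleR)

section \<open>Stability of the magnetic constraint\<close>

lemma bounded_linear_mag_component: "bounded_linear (\<lambda>U. mag U $ i)"
  unfolding mag_def
  by (intro bounded_linear_compose[OF bounded_linear_vec_nth]
      bounded_linear_compose[OF bounded_linear_fst] bounded_linear_compose[OF bounded_linear_snd]
      bounded_linear_snd)

lemma mag_component_simps:
  "mag (U + V) $ i = mag U $ i + mag V $ i" "mag (a *\<^sub>R U) $ i = a * mag U $ i"
  by (simp_all add: mag_def)

lemma mag_component_sum: "mag (\<Sum>l\<in>A. c l *\<^sub>R U l) $ i = (\<Sum>l\<in>A. c l * mag (U l) $ i)"
  using linear_sum[OF bounded_linear.linear[OF bounded_linear_mag_component[of i]], of "\<lambda>l. c l *\<^sub>R U l" A]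
  by (simp add: mag_component_simps)

lemma mag_component_differentiable:
  fixes u :: "real^'d::finite \<Rightarrow> state"
  assumes "u \<in> poly_space k"
  shows "(\<lambda>y. mag (u y) $ i) differentiable (at x)"
  using assms poly_space_differentiable
    poly_space_linear_image[OF bounded_linear.linear[OF bounded_linear_mag_component]] by blast

lemma div_mag_const: "div_mag D (\<lambda>x. W) x = 0"
  by (simp add: div_mag_def)

text \<open>\<open>frechet_derivative\<close> is a choice, additive where both maps are
  differentiable; the polynomial hypotheses supply this.\<close>

lemma div_mag_add:
  assumes "u \<in> poly_space k" "v \<in> poly_space k"
  shows "div_mag D (\<lambda>x. u x + v x) x = div_mag D u x + div_mag D v x"
proof -
  have "frechet_derivative (\<lambda>y. mag (u y + v y) $ lab D i) (at x)
      = (\<lambda>h. frechet_derivative (\<lambda>y. mag (u y) $ lab D i) (at x) h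
        + frechet_derivative (\<lambda>y. mag (v y) $ lab D i) (at x) h)" for i
    unfolding mag_component_simps
    by (intro frechet_derivative_at[symmetric] has_derivative_add
        frechet_derivative_works[THEN iffD1] mag_component_differentiable[OF assms(1)]
        mag_component_differentiable[OF assms(2)])
  then show ?thesis by (simp add: div_mag_def sum.distrib)
qed

lemma div_mag_scaleR:
  assumes "u \<in> poly_space k"
  shows "div_mag D (\<lambda>x. a *\<^sub>R u x) x = a * div_mag D u x"
proof -
  have "frechet_derivative (\<lambda>y. mag (a *\<^sub>R u y) $ lab D i) (at x)
      = (\<lambda>h. a * frechet_derivative (\<lambda>y. mag (u y) $ lab D i) (at x) h)" for i
    unfolding mag_component_simps
    by (intro frechet_derivative_at[symmetric] has_derivative_mult_right
      frechet_derivative_works[THEN iffD1] mag_component_differentiable[OF assms])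
  then show ?thesis by (simp add: div_mag_def sum_distrib_left)
qed

lemma div_mag_sum:
  assumes "finite A" "\<And>l. l \<in> A \<Longrightarrow> u l \<in> poly_space k"
  shows "div_mag D (\<lambda>x. \<Sum>l\<in>A. u l x) x = (\<Sum>l\<in>A. div_mag D (u l) x)"
  using assms
proof (induction A rule: finite_induct)
  case empty
  then show ?case using div_mag_const by simp
next
  case (insert l A)
  then have "div_mag D (\<lambda>x. u l x + (\<Sum>l\<in>A. u l x)) x
      = div_mag D (u l) x + div_mag D (\<lambda>x. \<Sum>l\<in>A. u l x) x"
    by (intro div_mag_add[of _ k] poly_space_sum) auto
  then show ?case using insert by simp
qed

text \<open>For d = 1 the constraint is affine, and weights summing to 1 keep the value
  \<open>B_const D\<close>; otherwise it is linear.\<close>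

lemma magnetic_constraint_combination:
  fixes D :: "'d::finite scheme"
  assumes A: "finite A" "(\<Sum>l\<in>A. c l) = 1" and u: "\<And>l. l \<in> A \<Longrightarrow> u l \<in> poly_space k"
    and constr: "\<And>l. l \<in> A \<Longrightarrow> magnetic_constraint D K (u l)"
  shows "magnetic_constraint D K (\<lambda>x. \<Sum>l\<in>A. c l *\<^sub>R u l x)"
proof (cases "CARD('d) = 1")
  case True
  have "mag (\<Sum>l\<in>A. c l *\<^sub>R u l x) $ 1 = B_const D" if "x \<in> K" for x
  proof -
    have "mag (\<Sum>l\<in>A. c l *\<^sub>R u l x) $ 1 = (\<Sum>l\<in>A. c l * mag (u l x) $ 1)"
      by (rule mag_component_sum)
    also have "\<dots> = (\<Sum>l\<in>A. c l * B_const D)"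
      using constr that True by (simp add: magnetic_constraint_def)
    finally show ?thesis using A by (simp flip: sum_distrib_right)
  qed
  then show ?thesis using True by (simp add: magnetic_constraint_def)
next
  case False
  have "div_mag D (\<lambda>x. \<Sum>l\<in>A. c l *\<^sub>R u l x) x = 0" if "x \<in> K" for x
  proof -
    have "div_mag D (\<lambda>x. \<Sum>l\<in>A. c l *\<^sub>R u l x) x = (\<Sum>l\<in>A. div_mag D (\<lambda>x. c l *\<^sub>R u l x) x)"
      by (intro div_mag_sum[of _ _ k] A poly_space_scaleR u)
    also have "\<dots> = 0"
      using div_mag_scaleR[OF u] constr that False by (simp add: magnetic_constraint_def)
    finally show ?thesis .
  qed
  then show ?thesis using False by (simp add: magnetic_constraint_def)
qed

text \<open>The residual satisfies the homogeneous constraint, so any multiple of it may be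
  added.\<close>

lemma magnetic_constraint_FE_update:
  fixes D :: "'d::finite scheme"
  assumes "residual_ok D U" "K \<in> cells D" "fst U K \<in> poly_space (deg D)"
    "magnetic_constraint D K (fst U K)"
  shows "magnetic_constraint D K (FE_update D U \<tau> K)"
proof -
  have res: "residual D U K \<in> poly_space (deg D)"
    using assms by (simp add: residual_ok_def)
  have "div_mag D (FE_update D U \<tau> K) x = div_mag D (fst U K) x + \<tau> * div_mag D (residual D U K) x" for x
    unfolding FE_update_def
    using div_mag_add[OF assms(3) poly_space_scaleR[OF res]] div_mag_scaleR[OF res] by metis
  then show ?thesis
    using assms by (auto simp: magnetic_constraint_def residual_ok_def FE_update_def
        mag_component_simps)
qed

lemma magnetic_constraint_scale_about:
  fixes D :: "'d::finite scheme"
  assumes quad: "cell_quadrature D K" and K: "compact K" and u: "u \<in> poly_space (deg D)"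
    and constr: "magnetic_constraint D K u"
  shows "magnetic_constraint D K (scale_about (cell_avg K u) \<theta> u)"
proof (cases "CARD('d) = 1")
  case True
  \<comment> \<open>Exactness turns the average into a combination of values at nodes in
    \<open>K\<close>, where the constraint holds, so the centre of the contraction satisfies it
    too.\<close>
  have "mag (cell_avg K u) $ 1 = mag (\<Sum>x\<in>nodes D K. weight D K x *\<^sub>R u x) $ 1"
    using quadrature_exact[OF quad K u] by simp
  also have "\<dots> = (\<Sum>x\<in>nodes D K. weight D K x * mag (u x) $ 1)"
    by (rule mag_component_sum)
  also have "\<dots> = (\<Sum>x\<in>nodes D K. weight D K x * B_const D)"
    using constr True quad by (intro sum.cong) (auto simp: magnetic_constraint_def cell_quadrature_def)
  also have "\<dots> = B_const D"
    using quad by (simp add: cell_quadrature_def flip: sum_distrib_right)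
  finally show ?thesis
    using constr True
    by (simp add: magnetic_constraint_def scale_about_eq mag_component_simps left_diff_distrib)
next
  case False
  have "div_mag D (scale_about (cell_avg K u) \<theta> u) x = \<theta> * div_mag D u x" for x
    unfolding scale_about_eq
    using div_mag_add[OF poly_space_const poly_space_scaleR[OF u]] div_mag_scaleR[OF u]
    by (simp add: div_mag_const)
  then show ?thesis using constr False by (simp add: magnetic_constraint_def)
qed

section \<open>Lifting\<close>

lemma continuous_on_eta:
  assumes "admissible_entropy_fun \<gamma> f" "\<gamma> > 1"
  shows "continuous_on Gset (eta \<gamma> f)"
proof -
  have cf: "continuous_on UNIV f"
    using admissible_entropy_fun_derivs(1)[OF assms(1)]
    by (meson DERIV_continuous_on has_field_derivative_at_within)
  \<comment> \<open>Written in projections so that the continuity rules apply; membership in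
    \<open>Gset\<close> keeps the divisor nonzero and the logarithms defined.\<close>
  have "continuous_on Gset (\<lambda>U. - fst U * f (ln ((\<gamma> - 1) * (snd (snd (snd U))
      - (norm (fst (snd U)))\<^sup>2 / (2 * fst U) - (norm (fst (snd (snd U))))\<^sup>2 / 2)) - \<gamma> * ln (fst U)))"
    using assms(2)
    by (intro continuous_intros continuous_on_compose2[OF cf])
      (auto simp: Gset_def int_ener_def dens_def mom_def mag_def ener_def)
  then show ?thesis
    unfolding eta_def spec_entropy_def pres_def int_ener_def
    by (simp add: dens_def mom_def mag_def ener_def)
qed

lemma scale_about_in_Gset:
  assumes "W \<in> Gset" "u x \<in> Gset" "0 \<le> \<theta>" "\<theta> \<le> 1"
  shows "scale_about W \<theta> u x \<in> Gset"
  unfolding scale_about_eq using convexD_alt[OF convex_Gset assms] .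

section \<open>Nodal entropy along the segment from the mean state\<close>

context
  fixes \<gamma> :: real and f :: "real \<Rightarrow> real" and N :: "'a set" and w :: "'a \<Rightarrow> real"
    and u :: "'a \<Rightarrow> state" and W :: state
  assumes f: "admissible_entropy_fun \<gamma> f" and \<gamma>: "\<gamma> > 1"
    and N: "finite N" and w: "\<And>x. x \<in> N \<Longrightarrow> w x > 0" "(\<Sum>x\<in>N. w x) = 1"
    and u: "\<And>x. x \<in> N \<Longrightarrow> u x \<in> Gset" and W: "W = (\<Sum>x\<in>N. w x *\<^sub>R u x)"
begin

private abbreviation (input) "\<Phi> \<theta> \<equiv> \<Sum>x\<in>N. w x * eta \<gamma> f (scale_about W \<theta> u x)"

private lemma N_ne: "N \<noteq> {}"
  using w(2) by auto

private lemma W_in_Gset: "W \<in> Gset"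
  unfolding W using N w u
  by (intro convex_sum[OF N convex_Gset w(2)]) (auto intro: less_imp_le)

private lemma scaled_in_Gset: "x \<in> N \<Longrightarrow> 0 \<le> \<theta> \<Longrightarrow> \<theta> \<le> 1 \<Longrightarrow> scale_about W \<theta> u x \<in> Gset"
  using scale_about_in_Gset[of W u x \<theta>] W_in_Gset u by blast

private lemma profile_zero: "\<Phi> 0 = eta \<gamma> f W"
  using w(2) by (simp add: scale_about_def flip: sum_distrib_right)

text \<open>The scaled nodal states have weighted mean \<open>W\<close> for every \<theta>, so
  Jensen's inequality applies.\<close>

private lemma profile_ge: "0 \<le> \<theta> \<Longrightarrow> \<theta> \<le> 1 \<Longrightarrow> \<Phi> 0 \<le> \<Phi> \<theta>"
proof -
  assume \<theta>: "0 \<le> \<theta>" "\<theta> \<le> 1"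
  have "(\<Sum>x\<in>N. w x *\<^sub>R scale_about W \<theta> u x) = (\<Sum>x\<in>N. w x *\<^sub>R (W - \<theta> *\<^sub>R W)) + \<theta> *\<^sub>R (\<Sum>x\<in>N. w x *\<^sub>R u x)"
    by (simp add: scale_about_def algebra_simps sum.distrib sum_subtractf scaleR_sum_right)
  then have eq: "(\<Sum>x\<in>N. w x *\<^sub>R scale_about W \<theta> u x) = W"
    using w(2) W by (simp flip: scaleR_sum_left)
  have "eta \<gamma> f (\<Sum>x\<in>N. w x *\<^sub>R scale_about W \<theta> u x) \<le> \<Phi> \<theta>"
    using w scaled_in_Gset \<theta>
    by (intro convex_on_sum[OF N N_ne convex_on_eta[OF f \<gamma>]]) (auto intro: less_imp_le)
  then show ?thesis by (simp add: eq profile_zero)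
qed

text \<open>A strictly convex function on [0,t] with its minimum at 0 increases strictly. One node
  off the mean makes the weighted sum strict.\<close>

private lemma profile_less:
  assumes ne: "\<exists>x\<in>N. u x \<noteq> W" and st: "0 \<le> s" "s < t" "t \<le> 1"
  shows "\<Phi> s < \<Phi> t"
proof -
  have between: "\<Phi> (a * t) < (1 - a) * \<Phi> 0 + a * \<Phi> t" if a: "0 < a" "a < 1" for a
  proof -
    have comb: "scale_about W (a * t) u x = (1 - a) *\<^sub>R W + a *\<^sub>R scale_about W t u x" for x
      by (simp add: scale_about_def algebra_simps)
    have lt: "eta \<gamma> f (scale_about W (a * t) u x)
        < (1 - a) * eta \<gamma> f W + a * eta \<gamma> f (scale_about W t u x)"
      if "x \<in> N" "u x \<noteq> W" for x
    proof -
      have "W \<noteq> scale_about W t u x" using that(2) st by (simp add: scale_about_def)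
      then show ?thesis
        unfolding comb using that st a
        by (intro eta_strict_convex[OF f \<gamma> W_in_Gset scaled_in_Gset]) auto
    qed
    \<comment> \<open>At a node with \<open>u x = W\<close> both sides equal
      \<open>eta \<gamma> f W\<close>.\<close>
    have le: "eta \<gamma> f (scale_about W (a * t) u x)
        \<le> (1 - a) * eta \<gamma> f W + a * eta \<gamma> f (scale_about W t u x)" if "x \<in> N" for x
      using lt[OF that] by (cases "u x = W") (auto simp: scale_about_def algebra_simps)
    have "\<Phi> (a * t) < (\<Sum>x\<in>N. w x * ((1 - a) * eta \<gamma> f W + a * eta \<gamma> f (scale_about W t u x)))"
      using ne lt le w(1) by (intro sum_strict_mono_ex1[OF N]) (auto intro!: mult_left_mono less_imp_le)
    also have "\<dots> = (\<Sum>x\<in>N. w x) * ((1 - a) * eta \<gamma> f W) + a * \<Phi> t"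
      by (simp add: algebra_simps sum.distrib sum_subtractf sum_distrib_left sum_distrib_right)
    finally show ?thesis unfolding profile_zero w(2) by simp
  qed
  have ge: "\<Phi> 0 \<le> \<Phi> t" using profile_ge st by simp
  show ?thesis
  proof (cases "s = 0")
    case True
    \<comment> \<open>\<open>between\<close> excludes the endpoint 0, so the midpoint supplies the
      strict inequality.\<close>
    have "\<Phi> 0 \<le> \<Phi> (1 / 2 * t)" using st by (intro profile_ge) auto
    also have "\<dots> < (1 - 1 / 2) * \<Phi> 0 + 1 / 2 * \<Phi> t" by (rule between) auto
    finally show ?thesis using True by simp
  next
    case False
    \<comment> \<open>The point s has relative position s / t in [0,t].\<close>
    have "\<Phi> (s / t * t) < (1 - s / t) * \<Phi> 0 + s / t * \<Phi> t"
      using False st by (intro between) auto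
    also have "\<dots> \<le> (1 - s / t) * \<Phi> t + s / t * \<Phi> t"
      using ge st by (intro add_right_mono mult_left_mono) auto
    also have "\<dots> = \<Phi> t" by (simp add: algebra_simps)
    finally show ?thesis using st by simp
  qed
qed

private lemma profile_const: "\<not> (\<exists>x\<in>N. u x \<noteq> W) \<Longrightarrow> \<Phi> s = \<Phi> t"
  by (intro sum.cong) (auto simp: scale_about_def)

text \<open>Includes the constant profile. It allows each entropy's own factor to be replaced by the
  smaller common one.\<close>

lemma nodal_entropy_mono: "0 \<le> s \<Longrightarrow> s \<le> t \<Longrightarrow> t \<le> 1 \<Longrightarrow> \<Phi> s \<le> \<Phi> t"
  using profile_less[of s t] profile_const[of s t]
  by (cases "\<exists>x\<in>N. u x \<noteq> W"; cases "s = t") (auto intro: less_imp_le)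

text \<open>Existence is the intermediate value theorem, uniqueness strict monotonicity.\<close>

lemma nodal_entropy_unique_root:
  assumes b: "eta \<gamma> f W \<le> b" "b < \<Phi> 1"
  shows "\<exists>!\<theta>. \<theta> \<in> {0..<1} \<and> \<Phi> \<theta> = b"
proof -
  \<comment> \<open>A constant profile would give \<open>\<Phi> 0 = \<Phi> 1\<close>, against the
    two bounds on \<open>b\<close>.\<close>
  have ne: "\<exists>x\<in>N. u x \<noteq> W"
    using profile_const[of 0 1] b profile_zero by fastforce
  have "continuous_on {0..1} (\<lambda>\<theta>. eta \<gamma> f (scale_about W \<theta> u x))" if "x \<in> N" for x
    using scaled_in_Gset[OF that]
    by (intro continuous_on_compose2[OF continuous_on_eta[OF f \<gamma>]])
      (auto simp: scale_about_def intro!: continuous_intros)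
  then have "continuous_on {0..1} \<Phi>"
    by (intro continuous_intros) auto
  then obtain \<theta> where \<theta>: "0 \<le> \<theta>" "\<theta> \<le> 1" "\<Phi> \<theta> = b"
    using IVT'[of \<Phi> 0 b 1] b profile_zero by auto
  then have "\<theta> \<noteq> 1" using b by auto
  have "\<theta>' = \<theta>" if "\<theta>' \<in> {0..<1}" "\<Phi> \<theta>' = b" for \<theta>'
    using profile_less[OF ne, of \<theta> \<theta>'] profile_less[OF ne, of \<theta>' \<theta>] that \<theta>
    by (cases \<theta> \<theta>' rule: linorder_cases) auto
  then show ?thesis using \<theta> \<open>\<theta> \<noteq> 1\<close> by (intro ex1I[of _ \<theta>]) auto
qed

end

section \<open>Attainment of the largest positivity-preserving factor\<close>

lemma theta_PP_in_Gset:
  fixes D :: "'d::finite scheme" and K :: "(real^'d) set" and u :: "real^'d \<Rightarrow> state"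
  assumes W: "W \<in> Gset" and eps: "0 < \<epsilon>\<rho>" "\<epsilon>\<rho> \<le> dens W" "0 < \<epsilon>p" "\<epsilon>p \<le> pres (gam D) W"
    and gam: "gam D > 1"
    and x: "x \<in> check_set D K"
  defines "\<theta> \<equiv> theta_PP D K \<epsilon>\<rho> \<epsilon>p W u"
  shows "scale_about W \<theta> u x \<in> Gset"
proof -
  \<comment> \<open>The factors satisfying \<open>P\<close> form a compact set containing 0, so its
    maximum exists and \<open>GREATEST\<close> satisfies the predicate.\<close>
  define P where "P = (\<lambda>\<theta>. \<theta> \<in> {0..1} \<and>
     (\<forall>x\<in>check_set D K. scale_about W \<theta> u x \<in> Gset_eps (gam D) \<epsilon>\<rho> \<epsilon>p))"
  define C where "C x = {\<theta>\<in>{0..1}. scale_about W \<theta> u x \<in> Gset_eps (gam D) \<epsilon>\<rho> \<epsilon>p}" for x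
  \<comment> \<open>Positive thresholds absorb the strict inequalities of \<open>Gset\<close>,
    leaving closed conditions.\<close>
  have Geps: "U \<in> Gset_eps (gam D) \<epsilon>\<rho> \<epsilon>p \<longleftrightarrow> \<epsilon>\<rho> \<le> dens U \<and> \<epsilon>p \<le> pres (gam D) U" for U
    using eps gam by (auto simp: Gset_eps_def Gset_def pres_def zero_less_mult_iff dest: less_le_trans)
  have "closed (C x)" for x
  proof -
    \<comment> \<open>The density bound comes first: on \<open>A\<close> the pressure has a nonzero
      divisor and is continuous.\<close>
    define A where "A = {\<theta>\<in>{0..1}. \<epsilon>\<rho> \<le> dens (scale_about W \<theta> u x)}"
    have "closed A"
      unfolding A_def dens_def scale_about_def
      by (intro continuous_on_closed_Collect_le continuous_intros)
    moreover have "continuous_on A (\<lambda>\<theta>. pres (gam D) (scale_about W \<theta> u x))"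
      unfolding pres_def int_ener_def dens_def mom_def mag_def ener_def scale_about_def
      using eps by (intro continuous_intros) (auto simp: A_def dens_def scale_about_def)
    ultimately have "closed {\<theta> \<in> A. \<epsilon>p \<le> pres (gam D) (scale_about W \<theta> u x)}"
      by (intro continuous_on_closed_Collect_le continuous_intros)
    also have "{\<theta> \<in> A. \<epsilon>p \<le> pres (gam D) (scale_about W \<theta> u x)} = C x"
      by (auto simp: A_def C_def Geps)
    finally show ?thesis .
  qed
  then have "closed ({0..1} \<inter> (\<Inter>x\<in>check_set D K. C x))" by (intro closed_Int closed_INT) auto
  moreover have "{\<theta>. P \<theta>} = {0..1} \<inter> (\<Inter>x\<in>check_set D K. C x)"
    by (auto simp: P_def C_def)
  ultimately have "compact {\<theta>. P \<theta>}"
    by (simp add: compact_eq_bounded_closed bounded_Int)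
  \<comment> \<open>The factor 0 collapses everything to \<open>W\<close>, which meets both
    thresholds.\<close>
  moreover have "0 \<in> {\<theta>. P \<theta>}" using eps by (auto simp: P_def scale_about_def Geps)
  ultimately obtain t where "P t" "\<And>s. P s \<Longrightarrow> s \<le> t"
    using compact_attains_sup[of "{\<theta>. P \<theta>}"] by blast
  then have "P (Greatest P)" by (rule GreatestI2_order)
  then have "P \<theta>" by (simp add: \<theta>_def theta_PP_def P_def)
  then show ?thesis using x
    by (auto simp: P_def Gset_eps_def)
qed

section \<open>Bounds for the multistep averages, then the lifting, on a fixed cell\<close>

theorem theorem5p1:
  fixes D :: "'d::finite scheme"
    and m :: nat
    and c d :: "nat \<Rightarrow> real"
    and \<Delta>t :: real
    and V :: "nat \<Rightarrow> 'd dfield"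
    and Ustar :: "'d pfield"
    and b :: "(real^'d) set \<Rightarrow> nat \<Rightarrow> real"
  assumes "standing_assumptions D"
    and "\<And>l. l < m \<Longrightarrow> c l > 0 \<Longrightarrow> admissible D (V l)"
    and "\<And>l. l < m \<Longrightarrow> c l \<ge> 0 \<and> d l \<ge> 0"
    and "(\<Sum>l<m. c l) = 1"
    and "\<And>l. l < m \<Longrightarrow> c l = 0 \<Longrightarrow> d l = 0"
    and "\<Delta>t > 0"
    and "\<And>l. l < m \<Longrightarrow> d l > 0 \<Longrightarrow> \<Delta>t \<le> c l / d l * tau_FE D (V l)"
  defines "Ustar \<equiv> multistep_update D m c d \<Delta>t V"
    and "b \<equiv> multistep_budget D m c d \<Delta>t V"
  shows "\<forall>K\<in>cells D.
      cell_avg K (Ustar K) \<in> Gset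
      \<and> (\<forall>r\<in>{1..num_ent D}. entropy D r (cell_avg K (Ustar K)) \<le> b K r)
      \<and> (\<forall>\<epsilon>\<rho> \<epsilon>p. 0 < \<epsilon>\<rho> \<and> \<epsilon>\<rho> < dens (cell_avg K (Ustar K))
            \<and> 0 < \<epsilon>p \<and> \<epsilon>p < pres (gam D) (cell_avg K (Ustar K)) \<longrightarrow>
          (let Unew = lifted D K \<epsilon>\<rho> \<epsilon>p (cell_avg K (Ustar K)) (b K) (Ustar K) in
             cell_avg K Unew = cell_avg K (Ustar K)
             \<and> magnetic_constraint D K Unew
             \<and> (\<forall>x\<in>check_set D K. Unew x \<in> Gset)
             \<and> (\<forall>r\<in>{1..num_ent D}. quad_entropy D K r Unew \<le> b K r)))"
proof (intro ballI conjI allI impI)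
  fix K assume K: "K \<in> cells D"
  define A where "A = {l. l < m \<and> c l > 0}"
  define \<tau> where "\<tau> l = d l / c l * \<Delta>t" for l
  define Y where "Y l = FE_update D (V l) (\<tau> l) K" for l
  define W where "W = cell_avg K (Ustar K)"
  have disc: "discretisation D" using assms(1) by (simp add: standing_assumptions_def)
  have gam: "gam D > 1" and ent: "\<And>r. r \<in> {1..num_ent D} \<Longrightarrow> admissible_entropy_fun (gam D) (ent_fun D r)"
    and quad: "cell_quadrature D K" and num_ent: "num_ent D \<ge> 1"
    using disc K by (auto simp: discretisation_def)
  have comp: "compact K" using cells_compact[OF disc K] .
  have A: "finite A" by (simp add: A_def)
  \<comment> \<open>The update sums over \<open>c l > 0\<close>, the budget over
    \<open>c l \<noteq> 0\<close>; nonnegativity identifies the two index sets.\<close>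
  have A_alt: "A = {l. l < m \<and> c l \<noteq> 0}"
    using assms(3) by (auto simp: A_def order_less_le)
  have "(\<Sum>l\<in>A. c l) = (\<Sum>l<m. c l)"
    unfolding A_alt by (rule sum.mono_neutral_left) auto
  then have sum_c: "(\<Sum>l\<in>A. c l) = 1" using assms(4) by simp
  have adm: "admissible D (V l)" if "l \<in> A" for l
    using assms(2) that by (simp add: A_def)
  have polyV: "fst (V l) K \<in> poly_space (deg D)" and magV: "magnetic_constraint D K (fst (V l) K)"
    if "l \<in> A" for l
    using adm[OF that] K by (auto simp: admissible_def)
  have res: "residual_ok D (V l)" and FE: "forward_Euler_property D (V l)" if "l \<in> A" for l
    using adm[OF that] assms(1) unfolding standing_assumptions_def by blast+
  have polyY: "Y l \<in> poly_space (deg D)" if "l \<in> A" for l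
    using polyV[OF that] res[OF that] K unfolding Y_def residual_ok_def
    by (intro poly_space_FE_update) auto
  \<comment> \<open>For \<open>d l > 0\<close> the factor \<open>c l / d l\<close> in the time step
    bound cancels; for \<open>d l = 0\<close> the substep is 0, which the forward Euler property
    allows.\<close>
  have \<tau>: "0 \<le> \<tau> l \<and> \<tau> l \<le> tau_FE D (V l)" if "l \<in> A" for l
  proof (cases "d l > 0")
    case True
    have cl: "l < m" "c l > 0" using that by (auto simp: A_def)
    have "\<Delta>t \<le> c l / d l * tau_FE D (V l)" using assms(7) cl True by blast
    then have "d l / c l * \<Delta>t \<le> d l / c l * (c l / d l * tau_FE D (V l))"
      using True cl by (intro mult_left_mono) auto
    then show ?thesis using True cl assms(6) by (simp add: \<tau>_def)
  next
    case False
    then have "d l = 0" using assms(3)[of l] that by (auto simp: A_def)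
    then show ?thesis using FE[OF that] by (simp add: \<tau>_def forward_Euler_property_def)
  qed
  have YG: "cell_avg K (Y l) \<in> Gset" if "l \<in> A" for l
    using FE[OF that] \<tau>[OF that] K by (simp add: forward_Euler_property_def Y_def)
  have Yent: "entropy D r (cell_avg K (Y l)) \<le> FE_budget D K r (V l) (\<tau> l)"
    if "l \<in> A" "r \<in> {1..num_ent D}" for l r
    using FE[OF that(1)] \<tau>[OF that(1)] K that(2) by (simp add: forward_Euler_property_def Y_def)
  have Ustar: "Ustar K = (\<lambda>x. \<Sum>l\<in>A. c l *\<^sub>R Y l x)"
    by (simp add: Ustar_def multistep_update_def A_def Y_def \<tau>_def fun_eq_iff)
  have polyU: "Ustar K \<in> poly_space (deg D)"
    unfolding Ustar by (intro poly_space_sum poly_space_scaleR polyY)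
  \<comment> \<open>The average is a convex combination of forward Euler averages, so membership
    follows from convexity of \<open>Gset\<close>, the bound from that of
    \<open>eta\<close>.\<close>
  have W: "W = (\<Sum>l\<in>A. c l *\<^sub>R cell_avg K (Y l))"
    unfolding W_def Ustar
    by (subst cell_avg_sum[OF A])
      (auto intro!: poly_space_integrable[OF comp] poly_space_scaleR polyY simp: cell_avg_scaleR)
  have c_pos: "c l \<ge> 0" if "l \<in> A" for l using that by (simp add: A_def)
  have WG: "W \<in> Gset"
    unfolding W by (intro convex_sum[OF A convex_Gset sum_c] c_pos YG)
  then show "cell_avg K (Ustar K) \<in> Gset" by (simp add: W_def)
  have Went: "entropy D r W \<le> b K r" if r: "r \<in> {1..num_ent D}" for r
  proof -
    \<comment> \<open>Jensen's inequality; \<open>sum_c\<close> also shows that \<open>A\<close> is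
      nonempty.\<close>
    have "entropy D r W \<le> (\<Sum>l\<in>A. c l * entropy D r (cell_avg K (Y l)))"
      unfolding W using sum_c
      by (intro convex_on_sum[OF A _ convex_on_eta[OF ent[OF r] gam]] c_pos YG) auto
    also have "\<dots> \<le> (\<Sum>l\<in>A. c l * FE_budget D K r (V l) (\<tau> l))"
      by (intro sum_mono mult_left_mono c_pos Yent r)
    also have "\<dots> = b K r" by (simp add: b_def multistep_budget_def A_alt \<tau>_def)
    finally show ?thesis .
  qed
  then show "entropy D r (cell_avg K (Ustar K)) \<le> b K r" if "r \<in> {1..num_ent D}" for r
    using that by (simp add: W_def)
  have magU: "magnetic_constraint D K (Ustar K)"
    unfolding Ustar using polyV magV res K
    by (intro magnetic_constraint_combination[OF A sum_c polyY])
      (auto simp: Y_def intro!: magnetic_constraint_FE_update)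
  fix \<epsilon>\<rho> \<epsilon>p
  assume "0 < \<epsilon>\<rho> \<and> \<epsilon>\<rho> < dens (cell_avg K (Ustar K))
    \<and> 0 < \<epsilon>p \<and> \<epsilon>p < pres (gam D) (cell_avg K (Ustar K))"
  then have eps: "0 < \<epsilon>\<rho>" "\<epsilon>\<rho> \<le> dens W" "0 < \<epsilon>p" "\<epsilon>p \<le> pres (gam D) W"
    by (auto simp: W_def)
  define \<theta> where "\<theta> = theta_PP D K \<epsilon>\<rho> \<epsilon>p W (Ustar K)"
  define u where "u = scale_about W \<theta> (Ustar K)"
  have uG: "u x \<in> Gset" if "x \<in> check_set D K" for x
    unfolding u_def \<theta>_def using theta_PP_in_Gset[OF WG eps gam that] .
  have polyu: "u \<in> poly_space (deg D)"
    unfolding u_def by (intro poly_space_scale_about polyU)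
  have nodes: "finite (nodes D K)" "\<And>x. x \<in> nodes D K \<Longrightarrow> weight D K x > 0"
    "(\<Sum>x\<in>nodes D K. weight D K x) = 1" "nodes D K \<subseteq> check_set D K"
    using quad by (auto simp: cell_quadrature_def)
  \<comment> \<open>Exactness makes \<open>W\<close> the weighted nodal mean of \<open>u\<close>,
    which Jensen's inequality at the nodes requires.\<close>
  have avg_u: "W = (\<Sum>x\<in>nodes D K. weight D K x *\<^sub>R u x)"
    unfolding quadrature_exact[OF quad comp polyu]
    by (simp add: u_def cell_avg_scale_about[OF quad comp polyU W_def])
  have uGn: "\<And>x. x \<in> nodes D K \<Longrightarrow> u x \<in> Gset" using uG nodes(4) by blast
  define t where "t = theta_ent D K \<epsilon>\<rho> \<epsilon>p W (b K) (Ustar K)"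
  have profile: "entropy_profile D K \<epsilon>\<rho> \<epsilon>p W (Ustar K) r s
      = (\<Sum>x\<in>nodes D K. weight D K x * entropy D r (scale_about W s u x))" for r s
    by (simp add: entropy_profile_def quad_entropy_def u_def \<theta>_def)
  \<comment> \<open>Either the factor is 1 and the bound already holds, or uniqueness of the root
    makes the \<open>THE\<close> term meaningful and the bound an equality.\<close>
  have t: "t r \<in> {0..1} \<and> entropy_profile D K \<epsilon>\<rho> \<epsilon>p W (Ustar K) r (t r) \<le> b K r"
    if r: "r \<in> {1..num_ent D}" for r
  proof (cases "entropy_profile D K \<epsilon>\<rho> \<epsilon>p W (Ustar K) r 1 \<le> b K r")
    case True
    then show ?thesis by (simp add: t_def theta_ent_def)
  next
    case False
    then have "\<exists>!s. s \<in> {0..<1} \<and> entropy_profile D K \<epsilon>\<rho> \<epsilon>p W (Ustar K) r s = b K r"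
      using nodal_entropy_unique_root[OF ent[OF r] gam nodes(1-3) uGn avg_u Went[OF r]]
      by (simp add: profile)
    from theI'[OF this] False show ?thesis by (simp add: t_def theta_ent_def)
  qed
  define \<mu> where "\<mu> = Min (t ` {1..num_ent D})"
  \<comment> \<open>At least one entropy exists, so the minimum is one of the factors and lies in
    [0,1].\<close>
  have "\<mu> \<in> t ` {1..num_ent D}" unfolding \<mu>_def using num_ent by (intro Min_in) auto
  then have \<mu>: "0 \<le> \<mu>" "\<mu> \<le> 1" using t by auto
  have lifted: "lifted D K \<epsilon>\<rho> \<epsilon>p W (b K) (Ustar K) = scale_about W \<mu> u"
    by (simp add: lifted_def u_def \<theta>_def \<mu>_def t_def scale_about_scale_about mult.commute)
  have "cell_avg K (scale_about W \<mu> u) = W"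
    unfolding u_def scale_about_scale_about
    by (rule cell_avg_scale_about[OF quad comp polyU W_def])
  moreover have "magnetic_constraint D K (scale_about W \<mu> u)"
    unfolding u_def scale_about_scale_about W_def
    by (rule magnetic_constraint_scale_about[OF quad comp polyU magU])
  moreover have "\<forall>x\<in>check_set D K. scale_about W \<mu> u x \<in> Gset"
    using scale_about_in_Gset[where W = W and u = u and \<theta> = \<mu>] WG uG \<mu> by simp
  moreover have "quad_entropy D K r (scale_about W \<mu> u) \<le> b K r" if r: "r \<in> {1..num_ent D}" for r
  proof -
    have "\<mu> \<le> t r" unfolding \<mu>_def using r by (intro Min_le) auto
    \<comment> \<open>Shrinking the factor from \<open>t r\<close> to \<mu> cannot raise the nodal
      entropy.\<close>
    then have "quad_entropy D K r (scale_about W \<mu> u)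
        \<le> entropy_profile D K \<epsilon>\<rho> \<epsilon>p W (Ustar K) r (t r)"
      unfolding profile quad_entropy_def using \<mu> t[OF r]
      by (intro nodal_entropy_mono[OF ent[OF r] gam nodes(1-3) uGn avg_u]) auto
    then show ?thesis using t[OF r] by simp
  qed
  ultimately show "let Unew = lifted D K \<epsilon>\<rho> \<epsilon>p (cell_avg K (Ustar K)) (b K) (Ustar K) in
     cell_avg K Unew = cell_avg K (Ustar K) \<and> magnetic_constraint D K Unew
     \<and> (\<forall>x\<in>check_set D K. Unew x \<in> Gset)
     \<and> (\<forall>r\<in>{1..num_ent D}. quad_entropy D K r Unew \<le> b K r)"
    unfolding Let_def W_def[symmetric] lifted by blast
qed

end
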